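(* Let $R=\begin{pmatrix}2&1\\0&2\end{pmatrix}$, $B=\left\{\begin{pmatrix}0\\0\end{pmatrix},\begin{pmatrix}1\\0\end{pmatrix}\right\}$, and let $\mu_{R,B}$ be the self-affine measure on $\mathbb{R}^2$ generated by $R$ and $B$. Then for every $t\in[0,1]$ the level set $$L_t:=\{\Lambda : \Lambda \text{ is a spectrum of } \mu_{R,B} \text{ and } \dim_{Be}(\Lambda)=t\}$$ has the cardinality of the continuum.
   Context: Self-affine measure: $\mu_{R,B}$ is the unique Borel probability measure on $\mathbb{R}^2$ satisfying $\mu(E)=\sum_{b\in B}\frac{1}{\#B}\,\mu(\varphi_b^{-1}(E))$ for all Borel sets $E\subseteq\mathbb{R}^2$, where $\varphi_b(x)=R^{-1}(x+b)$. Spectrum: a discrete set $\Lambda\subseteq\mathbb{R}^2$ is a spectrum of a Borel probability measure $\mu$ on $\mathbb{R}^2$ if $E(\Lambda)=\{e^{-2\pi i\langle\lambda,x\rangle}:\lambda\in\Lambda\}$ is an orthonormal basis of $L^2(\mu)$. Beurling density and dimension: for a discrete set $\Lambda\subseteq\mathbb{R}^2$ and $r>0$, the upper $r$-Beurling density is $D_r^+(\Lambda)=\limsup_{h\to\infty}\sup_{x\in\mathbb{R}^2}\frac{\#(\Lambda\cap B(x,h))}{h^r}$, where $B(x,h)$ is the open Euclidean ball with center $x$ and radius $h$. The Beurling dimension is $\dim_{Be}(\Lambda)=\inf\{r>0: D_r^+(\Lambda)=0\}=\sup\{r>0: D_r^+(\Lambda)=\infty\}$ (with the supremum of the empty set taken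 to be $0$). *)

theory Defs
  imports "HOL-Analysis.Analysis" "HOL-Probability.Probability_Measure"
begin

section \<open>Self-affine measures\<close>

definition ifs_map :: "real^'n^'n \<Rightarrow> real^'n \<Rightarrow> real^'n \<Rightarrow> real^'n" where
  "ifs_map R b x = matrix_inv R *v (x + b)"

definition is_self_affine_measure ::
  "real^'n^'n \<Rightarrow> (real^'n) set \<Rightarrow> (real^'n) measure \<Rightarrow> bool" where
  "is_self_affine_measure R B \<mu> \<longleftrightarrow>
     prob_space \<mu> \<and> sets \<mu> = sets borel \<and>
     (\<forall>E\<in>sets borel. measure \<mu> E =
        (\<Sum>b\<in>B. 1 / real (card B) * measure \<mu> (ifs_map R b -` E)))"

text \<open>The description is meaningful only for those \<open>R\<close> and \<open>B\<close> (e.g. \<open>R\<close> expanding, \<open>B\<close> finite and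
  nonempty) for which exactly one such measure exists.\<close>

definition self_affine_measure ::
  "real^'n^'n \<Rightarrow> (real^'n) set \<Rightarrow> (real^'n) measure" where
  "self_affine_measure R B = (THE \<mu>. is_self_affine_measure R B \<mu>)"


section \<open>Orthonormal bases of \<open>L\<^sup>2(\<mu>)\<close> and spectra\<close>

text \<open>Elements of \<open>L\<^sup>2(M)\<close> are represented by square-integrable functions; identification up to
  null sets is implicit, since only inner products and norms are used.\<close>

definition L2_space :: "'a measure \<Rightarrow> ('a \<Rightarrow> complex) set" where
  "L2_space M = {f \<in> borel_measurable M. integrable M (\<lambda>x. (cmod (f x))\<^sup>2)}"

definition L2_inner :: "'a measure \<Rightarrow> ('a \<Rightarrow> complex) \<Rightarrow> ('a \<Rightarrow> complex) \<Rightarrow> complex" where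
  "L2_inner M f g = (\<integral>x. f x * cnj (g x) \<partial>M)"

definition L2_norm :: "'a measure \<Rightarrow> ('a \<Rightarrow> complex) \<Rightarrow> real" where
  "L2_norm M f = sqrt (\<integral>x. (cmod (f x))\<^sup>2 \<partial>M)"

text \<open>Both notions concern indexed families: distinct indices must give orthogonal (in particular
  distinct) elements of \<open>L\<^sup>2(M)\<close>.\<close>

definition orthonormal_family :: "'a measure \<Rightarrow> ('i \<Rightarrow> 'a \<Rightarrow> complex) \<Rightarrow> 'i set \<Rightarrow> bool" where
  "orthonormal_family M e I \<longleftrightarrow>
     (\<forall>i\<in>I. e i \<in> L2_space M) \<and>
     (\<forall>i\<in>I. \<forall>j\<in>I. L2_inner M (e i) (e j) = (if i = j then 1 else 0))"

text \<open>Completeness: the finite linear combinations are dense in \<open>L\<^sup>2(M)\<close>.\<close>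

definition orthonormal_basis :: "'a measure \<Rightarrow> ('i \<Rightarrow> 'a \<Rightarrow> complex) \<Rightarrow> 'i set \<Rightarrow> bool" where
  "orthonormal_basis M e I \<longleftrightarrow>
     orthonormal_family M e I \<and>
     (\<forall>f\<in>L2_space M. \<forall>\<epsilon>>0. \<exists>J c. finite J \<and> J \<subseteq> I \<and>
        L2_norm M (\<lambda>x. f x - (\<Sum>j\<in>J. c j * e j x)) < \<epsilon>)"

definition exponential :: "'a::real_inner \<Rightarrow> 'a \<Rightarrow> complex" where
  "exponential \<xi> x = exp (- 2 * of_real pi * \<i> * of_real (\<xi> \<bullet> x))"

definition is_spectrum :: "'a::euclidean_space measure \<Rightarrow> 'a set \<Rightarrow> bool" where
  "is_spectrum \<mu> \<Lambda> \<longleftrightarrow> discrete \<Lambda> \<and> orthonormal_basis \<mu> exponential \<Lambda>"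


section \<open>Beurling density and Beurling dimension\<close>

text \<open>Points are counted by \<open>emeasure (count_space UNIV)\<close>, so that infinite sets have count \<open>\<infinity>\<close>
  (whereas \<open>card\<close> would give \<open>0\<close>).\<close>

definition upper_beurling_density :: "real \<Rightarrow> 'a::metric_space set \<Rightarrow> ennreal" where
  "upper_beurling_density r \<Lambda> =
     Limsup at_top (\<lambda>h::real.
       (SUP x. emeasure (count_space UNIV) (\<Lambda> \<inter> ball x h)) / ennreal (h powr r))"

text \<open>The values lie in \<open>[0,\<infinity>]\<close>, where \<open>Inf {} = \<infinity>\<close> and \<open>Sup {} = 0\<close>.\<close>

definition beurling_dim :: "'a::metric_space set \<Rightarrow> ennreal" where
  "beurling_dim \<Lambda> = Inf {ennreal r | r. 0 < r \<and> upper_beurling_density r \<Lambda> = 0}"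

lemma upper_beurling_density_eq_0:
  assumes fin: "upper_beurling_density r \<Lambda> \<noteq> \<infinity>" and "r < s"
  shows "upper_beurling_density s \<Lambda> = 0"
proof -
  define N where "N h = (SUP x. emeasure (count_space UNIV) (\<Lambda> \<inter> ball x h))" for h :: real
  obtain c where c: "upper_beurling_density r \<Lambda> < ennreal c" "c \<ge> 0"
  proof -
    obtain y where "y \<ge> 0" "upper_beurling_density r \<Lambda> = ennreal y"
      using fin by (cases "upper_beurling_density r \<Lambda>") auto
    then show ?thesis using that[of "y + 1"] by (simp add: ennreal_less_iff)
  qed
  have "\<forall>\<^sub>F h in at_top. N h / ennreal (h powr r) < ennreal c"
    using Limsup_lessD[OF c(1)[unfolded upper_beurling_density_def]] by (simp add: N_def)
  then have "\<forall>\<^sub>F h in at_top. N h / ennreal (h powr s) \<le> ennreal (c * h powr (r - s))"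
    using eventually_gt_at_top[of 0]
  proof eventually_elim
    case (elim h)
    from elim have "N h / ennreal (h powr r) \<noteq> \<infinity>" by auto
    with elim have "N h \<noteq> \<infinity>"
      by (auto simp: ennreal_divide_eq_top_iff ennreal_top_divide)
    then obtain n where n: "N h = ennreal n" "n \<ge> 0" by (cases "N h") auto
    from elim n have "n / h powr r < c"
      by (simp add: divide_ennreal ennreal_less_iff)
    then have "n / h powr s \<le> c * h powr (r - s)"
      using elim by (simp add: powr_diff field_simps)
    then show ?case using elim n by (simp add: divide_ennreal ennreal_leI)
  qed
  then have "upper_beurling_density s \<Lambda> \<le> Limsup at_top (\<lambda>h. ennreal (c * h powr (r - s)))"
    unfolding upper_beurling_density_def N_def by (rule Limsup_mono)
  also have "((\<lambda>h. ennreal (c * h powr (r - s))) \<longlongrightarrow> ennreal (c * 0)) at_top"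
    using \<open>r < s\<close> by (intro tendsto_ennrealI tendsto_mult tendsto_const tendsto_neg_powr filterlim_ident) auto
  then have "Limsup at_top (\<lambda>h. ennreal (c * h powr (r - s))) = 0"
    by (subst lim_imp_Limsup) auto
  finally show ?thesis by simp
qed

lemma beurling_dim_eq_Sup:
  "beurling_dim \<Lambda> = Sup {ennreal r | r. 0 < r \<and> upper_beurling_density r \<Lambda> = \<infinity>}" (is "_ = ?S")
proof (rule antisym)
  show "?S \<le> beurling_dim \<Lambda>"
    unfolding beurling_dim_def
  proof (intro Sup_least Inf_greatest, clarify)
    fix r s :: real
    assume "upper_beurling_density r \<Lambda> = \<infinity>" "upper_beurling_density s \<Lambda> = 0" "0 < r" "0 < s"
    then show "ennreal r \<le> ennreal s"
      using upper_beurling_density_eq_0[of s \<Lambda> r] by (intro ennreal_leI) force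
  qed
  show "beurling_dim \<Lambda> \<le> ?S"
  proof (rule ccontr)
    assume "\<not> ?thesis"
    then obtain u where u: "?S < u" "u < beurling_dim \<Lambda>" by (meson dense not_le)
    then obtain v where v: "u < v" "v < beurling_dim \<Lambda>" by (meson dense)
    obtain a where a: "u = ennreal a" "a \<ge> 0" using u by (cases u) auto
    obtain b where b: "v = ennreal b" "b \<ge> 0" using v by (cases v) auto
    have ab: "0 < a" "a < b" using u a b v by (auto simp: ennreal_less_iff intro: order_le_neq_trans)
    have "upper_beurling_density a \<Lambda> \<noteq> \<infinity>"
      using u(1) a ab by (auto simp: not_le[symmetric] intro: Sup_upper)
    from upper_beurling_density_eq_0[OF this ab(2)] have "beurling_dim \<Lambda> \<le> v"
      unfolding beurling_dim_def using ab b by (intro Inf_lower) auto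
    then show False using v by simp
  qed
qed

end

theory Submission
  imports Defs
begin

text \<open>
  The maps \<open>\<phi>\<^sub>b\<close> send \<open>(x, 0)\<close> to \<open>((x + b\<^sub>1) / 2, 0)\<close>, so the invariant measure is Lebesgue measure on the
  segment \<open>[0, 1] \<times> {0}\<close>. It does not see the second coordinate of a frequency: the graph of any
  function \<open>g : \<int> \<rightarrow> \<real>\<close> is a spectrum, because the exponentials with integer frequencies form an
  orthonormal basis of \<open>L\<^sup>2[0, 1]\<close>. The growth of \<open>g\<close> then prescribes the Beurling dimension:
  \<open>g(n) = |n| powr (1 / t) + a\<close> gives dimension \<open>t\<close> and \<open>g(n) = 2 ^ |n| + a\<close> gives dimension \<open>0\<close>, for every
  real \<open>a\<close>. In the other direction, a second countable space has at most continuum many discrete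
  subsets.
\<close>

section \<open>Uniqueness of self-affine measures\<close>

text \<open>\<open>self_affine_measure\<close> is a definite description, so invariance of the
  candidate is only half of its identification; uniqueness holds because \<open>matrix_inv R\<close>
  contracts, here with constant 3/4. In a ball of radius h the heights of the graph differ by less
  than 2 h, so the number of indices is governed by the inverse of the growth function: of order h^t
  for the power, log h for the exponential. The condition t \<le> 1 enters through 1/t \<ge> 1: the
  power is then superadditive, which bounds the count from above, and it dominates n itself, so that
  height alone decides membership in a ball in the count from below. The shift a is a vertical
  translation, which keeps the dimension and yields one set for each real number. Completeness is
  obtained on the circle, where Stone-Weierstrass applies. Since functions on (0, 1) need not be
  periodic, the passage back is made with indicators of closed sets.\<close>

lemma closed_indicator_lipschitz_limit:
  fixes C :: "'a::metric_space set"
  assumes "closed C"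
  obtains \<phi> :: "nat \<Rightarrow> 'a \<Rightarrow> real" where
    "\<And>k. \<exists>L. L-lipschitz_on UNIV (\<phi> k)" "\<And>k x. 0 \<le> \<phi> k x" "\<And>k x. \<phi> k x \<le> 1"
    "\<And>x. (\<lambda>k. \<phi> k x) \<longlonglongrightarrow> indicator C x"
\<comment> \<open>\<open>infdist x {}\<close> is 0 by convention, so for the empty set the formula
  below would give the constant 1.\<close>
proof (cases "C = {}")
  case True
  show ?thesis
    by (rule that[of "\<lambda>_ _. 0"]) (auto simp: True lipschitz_on_def intro!: exI[of _ 0])
next
  case False
  \<comment> \<open>A tent: 1 on \<open>C\<close>, falling with slope \<open>k\<close>, and 0 as
    soon as the distance to \<open>C\<close> reaches 1 / k.\<close>
  define \<phi> where "\<phi> k x = max 0 (1 - real k * infdist x C)" for k :: nat and x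
  show ?thesis
  proof (rule that[of \<phi>])
    show "\<exists>L. L-lipschitz_on UNIV (\<phi> k)" for k
    proof (intro exI lipschitz_onI)
      fix x y
      have "\<bar>real k * infdist x C - real k * infdist y C\<bar> \<le> real k * dist x y"
        using mult_left_mono[OF infdist_triangle_abs[of x C y], of "real k"]
        by (simp add: abs_mult flip: right_diff_distrib)
      then show "dist (\<phi> k x) (\<phi> k y) \<le> real k * dist x y"
        by (auto simp: \<phi>_def dist_real_def)
    qed auto
    show "0 \<le> \<phi> k x" "\<phi> k x \<le> 1" for k x
      using infdist_nonneg[of x C] by (auto simp: \<phi>_def)
    show "(\<lambda>k. \<phi> k x) \<longlonglongrightarrow> indicator C x" for x
    proof (cases "x \<in> C")
      case True
      then show ?thesis by (simp add: \<phi>_def)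
    next
      case x: False
      then have pos: "infdist x C > 0"
        using infdist_pos_not_in_closed[OF assms False x] by simp
      obtain K where K: "1 < real K * infdist x C"
        using ex_less_of_nat_mult[OF pos] by blast
      have "\<phi> k x = 0" if "k \<ge> K" for k
      proof -
        have "real K * infdist x C \<le> real k * infdist x C"
          using that pos by (intro mult_right_mono) auto
        then show ?thesis using K by (simp add: \<phi>_def)
      qed
      then have "eventually (\<lambda>k. \<phi> k x = 0) sequentially"
        by (auto simp: eventually_sequentially)
      then show ?thesis using x by (simp add: tendsto_eventually)
    qed
  qed
qed

lemma lipschitz_on_borel_measurable:
  fixes f :: "'a::metric_space \<Rightarrow> 'b::metric_space"
  assumes "L-lipschitz_on UNIV f"
  shows "f \<in> borel_measurable borel"
  using lipschitz_on_continuous_on[OF assms] by (rule borel_measurable_continuous_onI)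

text \<open>Such test functions reach the indicators of closed sets by bounded limits, and the
  closed sets are an intersection-stable generator of the Borel sets. The class is chosen because
  averaging over the maps of the system preserves it.\<close>

lemma measure_eqI_lipschitz:
  fixes M N :: "'a::metric_space measure"
  assumes M: "prob_space M" "sets M = sets borel" and N: "prob_space N" "sets N = sets borel"
    and eq: "\<And>f L. L-lipschitz_on UNIV f \<Longrightarrow> (\<And>x. 0 \<le> f x) \<Longrightarrow> (\<And>x. f x \<le> (1::real)) \<Longrightarrow>
      (\<integral>x. f x \<partial>M) = (\<integral>x. f x \<partial>N)"
  shows "M = N"
proof -
  interpret M: prob_space M by fact
  interpret N: prob_space N by fact
  note [measurable_cong] = M(2) N(2)
  have closed_eq: "emeasure M C = emeasure N C" if "closed C" for C
  proof -
    obtain \<phi> where \<phi>: "\<And>k. \<exists>L. L-lipschitz_on UNIV (\<phi> k)" "\<And>k x. 0 \<le> \<phi> k x"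
        "\<And>k x. \<phi> k x \<le> (1::real)" "\<And>x. (\<lambda>k. \<phi> k x) \<longlonglongrightarrow> indicator C x"
      using closed_indicator_lipschitz_limit[OF \<open>closed C\<close>] by metis
    have [measurable]: "\<phi> k \<in> borel_measurable borel" for k
      using \<phi>(1)[of k] lipschitz_on_borel_measurable by blast
    have C [measurable]: "C \<in> sets borel" using that by simp
    have lim: "(\<lambda>k. \<integral>x. \<phi> k x \<partial>P) \<longlonglongrightarrow> (\<integral>x. indicator C x \<partial>P)"
      if P: "prob_space P" and [measurable_cong]: "sets P = sets borel" for P :: "'a measure"
    proof (rule integral_dominated_convergence[where w = "\<lambda>_. 1"])
      interpret prob_space P by fact
      show "integrable P (\<lambda>_. 1::real)" by simp
    qed (use \<phi> in \<open>auto simp: abs_of_nonneg\<close>)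
    have "(\<integral>x. \<phi> k x \<partial>M) = (\<integral>x. \<phi> k x \<partial>N)" for k
      using \<phi>(1)[of k] eq \<phi>(2,3) by blast
    with lim[OF M] lim[OF N] have "(\<integral>x. indicator C x \<partial>M) = (\<integral>x. indicator C x \<partial>N :: real)"
      using LIMSEQ_unique by auto
    then have "measure M C = measure N C"
      using sets_eq_imp_space_eq[OF M(2)] sets_eq_imp_space_eq[OF N(2)] by simp
    then show ?thesis by (simp add: M.emeasure_eq_measure N.emeasure_eq_measure)
  qed
  show ?thesis
  proof (rule measure_eqI_generator_eq[where E = "Collect closed" and \<Omega> = UNIV and A = "\<lambda>_. UNIV"])
    show "Int_stable (Collect closed :: 'a set set)"
      by (auto simp: Int_stable_def)
    show "sets M = sigma_sets UNIV (Collect closed)" "sets N = sigma_sets UNIV (Collect closed)"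
      unfolding M N by (simp_all add: borel_eq_closed)
  qed (use closed_eq in auto)
qed

lemma borel_measurable_ifs_map [measurable]: "ifs_map R b \<in> borel_measurable borel"
  unfolding ifs_map_def
  by (intro borel_measurable_continuous_onI continuous_intros
      continuous_on_compose2[OF matrix_vector_mult_linear_continuous_on[of UNIV]]) auto

lemma self_affine_measure_nn_integral:
  assumes \<mu>: "is_self_affine_measure R B \<mu>" and f: "f \<in> borel_measurable borel"
  shows "(\<integral>\<^sup>+x. f x \<partial>\<mu>) = (\<Sum>b\<in>B. ennreal (1 / real (card B)) * (\<integral>\<^sup>+x. f (ifs_map R b x) \<partial>\<mu>))"
proof -
  interpret prob_space \<mu> using \<mu> by (simp add: is_self_affine_measure_def)
  have [measurable_cong]: "sets \<mu> = sets borel"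
    and inv: "\<And>E. E \<in> sets borel \<Longrightarrow> measure \<mu> E =
        (\<Sum>b\<in>B. 1 / real (card B) * measure \<mu> (ifs_map R b -` E))"
    using \<mu> by (auto simp: is_self_affine_measure_def)
  show ?thesis using f
  proof (induction rule: borel_measurable_induct)
    case (cong f g)
    then show ?case by simp
  next
    case (set A)
    note [measurable] = set
    have "(\<integral>\<^sup>+x. indicator A (ifs_map R b x) \<partial>\<mu>) = emeasure \<mu> (ifs_map R b -` A)" for b
    proof -
      have "(\<lambda>x. indicator A (ifs_map R b x) :: ennreal) = indicator (ifs_map R b -` A)"
        by (auto simp: indicator_def)
      then show ?thesis
        using measurable_sets[of "ifs_map R b" borel borel A] set by (simp add: \<open>sets \<mu> = sets borel\<close>)
    qed
    then show ?case
      using set inv[OF set]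
      by (simp add: emeasure_eq_measure sum_ennreal \<open>sets \<mu> = sets borel\<close> flip: ennreal_mult)
  next
    case (mult u c)
    then show ?case
      by (simp add: nn_integral_cmult sum_distrib_left mult.left_commute)
  next
    case (add u v)
    then show ?case
      by (simp add: nn_integral_add distrib_left sum.distrib)
  next
    case (seq U)
    note [measurable] = seq(1)
    \<comment> \<open>Stated for arbitrary \<open>h\<close> because it serves the identity on the
      left and each \<open>ifs_map R b\<close> on the right.\<close>
    have mono_lim: "(\<lambda>i. \<integral>\<^sup>+x. U i (h x) \<partial>\<mu>) \<longlonglongrightarrow> (\<integral>\<^sup>+x. (SUP i. U i) (h x) \<partial>\<mu>)"
      if [measurable]: "h \<in> borel_measurable borel" for h
    proof -
      have inc: "incseq (\<lambda>i x. U i (h x))"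
        using \<open>incseq U\<close> by (auto simp: mono_def le_fun_def)
      have "(\<integral>\<^sup>+x. (SUP i. U i) (h x) \<partial>\<mu>) = (SUP i. \<integral>\<^sup>+x. U i (h x) \<partial>\<mu>)"
        using nn_integral_monotone_convergence_SUP[OF inc, of \<mu>] by (simp add: image_comp)
      then show ?thesis
        using inc by (auto intro!: LIMSEQ_SUP nn_integral_mono simp: mono_def le_fun_def)
    qed
    from mono_lim[of "\<lambda>x. x"] have "(\<lambda>i. \<integral>\<^sup>+x. U i x \<partial>\<mu>) \<longlonglongrightarrow> (\<integral>\<^sup>+x. (SUP i. U i) x \<partial>\<mu>)"
      by simp
    moreover have "(\<lambda>i. \<integral>\<^sup>+x. U i x \<partial>\<mu>) \<longlonglongrightarrow>
        (\<Sum>b\<in>B. ennreal (1 / real (card B)) * (\<integral>\<^sup>+x. (SUP i. U i) (ifs_map R b x) \<partial>\<mu>))"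
      unfolding seq.IH by (intro tendsto_sum ennreal_tendsto_cmult mono_lim) auto
    ultimately show ?case using LIMSEQ_unique by blast
  qed
qed

lemma self_affine_measure_integral:
  assumes \<mu>: "is_self_affine_measure R B \<mu>" and f: "f \<in> borel_measurable borel"
    and nonneg: "\<And>x. 0 \<le> f x" and le: "\<And>x. f x \<le> (1::real)"
  shows "(\<integral>x. f x \<partial>\<mu>) = (\<integral>x. (\<Sum>b\<in>B. f (ifs_map R b x)) / real (card B) \<partial>\<mu>)"
proof -
  interpret prob_space \<mu> using \<mu> by (simp add: is_self_affine_measure_def)
  have [measurable_cong]: "sets \<mu> = sets borel" using \<mu> by (auto simp: is_self_affine_measure_def)
  note [measurable] = f
  have "(\<integral>x. f x \<partial>\<mu>) = enn2real (\<integral>\<^sup>+x. ennreal (f x) \<partial>\<mu>)"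
    by (rule integral_eq_nn_integral) (auto simp: nonneg)
  also have "(\<integral>\<^sup>+x. ennreal (f x) \<partial>\<mu>) =
      (\<Sum>b\<in>B. ennreal (1 / real (card B)) * (\<integral>\<^sup>+x. ennreal (f (ifs_map R b x)) \<partial>\<mu>))"
    by (rule self_affine_measure_nn_integral[OF \<mu>]) simp
  also have "\<dots> = (\<integral>\<^sup>+x. (\<Sum>b\<in>B. ennreal (1 / real (card B)) * ennreal (f (ifs_map R b x))) \<partial>\<mu>)"
    by (subst nn_integral_sum) (auto simp: nn_integral_cmult)
  also have "\<dots> = (\<integral>\<^sup>+x. ennreal ((\<Sum>b\<in>B. f (ifs_map R b x)) / real (card B)) \<partial>\<mu>)"
    by (simp add: sum_divide_distrib nonneg flip: ennreal_mult sum_ennreal)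
  also have "enn2real \<dots> = (\<integral>x. (\<Sum>b\<in>B. f (ifs_map R b x)) / real (card B) \<partial>\<mu>)"
    by (rule integral_eq_nn_integral[symmetric]) (auto simp: nonneg sum_nonneg)
  finally show ?thesis .
qed

text \<open>The averaging operator \<open>T f = (\<Sum>b\<in>B. f \<circ> \<phi>\<^sub>b) / #B\<close> preserves integrals and contracts Lipschitz
  constants, so \<open>T\<^sup>n f(0)\<close> converges to the integral of \<open>f\<close> under any invariant measure.\<close>

lemma is_self_affine_measure_unique:
  assumes \<mu>: "is_self_affine_measure R B \<mu>" and \<nu>: "is_self_affine_measure R B \<nu>"
    and B: "finite B" "B \<noteq> {}" and c: "0 \<le> c" "c < 1" "\<And>v. norm (matrix_inv R *v v) \<le> c * norm v"
  shows "\<mu> = \<nu>"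
proof (rule measure_eqI_lipschitz)
  show "prob_space \<mu>" "sets \<mu> = sets borel" "prob_space \<nu>" "sets \<nu> = sets borel"
    using \<mu> \<nu> by (auto simp: is_self_affine_measure_def)
  fix f :: "real^'a \<Rightarrow> real" and L
  assume f: "L-lipschitz_on UNIV f" "\<And>x. 0 \<le> f x" "\<And>x. f x \<le> 1"
  define N where "N = real (card B)"
  have N: "N > 0" using B by (simp add: N_def card_gt_0_iff)
  define T where "T g x = (\<Sum>b\<in>B. g (ifs_map R b x)) / N" for g :: "real^'a \<Rightarrow> real" and x
  have T_lip: "(c * K)-lipschitz_on UNIV (T g)" if g: "K-lipschitz_on UNIV g" for K g
  proof (rule lipschitz_onI)
    show "0 \<le> c * K" using lipschitz_on_nonneg[OF g] c by simp
    fix x y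
    have "\<bar>g (ifs_map R b x) - g (ifs_map R b y)\<bar> \<le> K * (c * dist x y)" for b
    proof -
      have "matrix_inv R *v (x + b) - matrix_inv R *v (y + b) = matrix_inv R *v (x - y)"
        by (simp flip: matrix_vector_mult_diff_distrib)
      then have "dist (ifs_map R b x) (ifs_map R b y) \<le> c * dist x y"
        using c(3)[of "x - y"] by (simp add: ifs_map_def dist_norm)
      then have "K * dist (ifs_map R b x) (ifs_map R b y) \<le> K * (c * dist x y)"
        using lipschitz_on_nonneg[OF g] by (rule mult_left_mono)
      with lipschitz_onD[OF g, of "ifs_map R b x" "ifs_map R b y"] show ?thesis
        by (simp add: dist_real_def)
    qed
    then have "(\<Sum>b\<in>B. \<bar>g (ifs_map R b x) - g (ifs_map R b y)\<bar>) \<le> N * (K * (c * dist x y))"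
      using sum_bounded_above[of B "\<lambda>b. \<bar>g (ifs_map R b x) - g (ifs_map R b y)\<bar>"] by (simp add: N_def)
    then have "\<bar>\<Sum>b\<in>B. g (ifs_map R b x) - g (ifs_map R b y)\<bar> \<le> N * (K * (c * dist x y))"
      by (rule order_trans[OF sum_abs])
    then have "\<bar>\<Sum>b\<in>B. g (ifs_map R b x) - g (ifs_map R b y)\<bar> / N \<le> c * K * dist x y"
      using N by (simp add: field_simps)
    then show "dist (T g x) (T g y) \<le> c * K * dist x y"
      using N by (simp add: T_def dist_real_def sum_subtractf flip: diff_divide_distrib)
  qed
  have T_bounds: "0 \<le> T g x \<and> T g x \<le> 1" if "\<And>x. 0 \<le> g x \<and> g x \<le> 1" for g x
    using that sum_nonneg[of B "\<lambda>b. g (ifs_map R b x)"]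
      sum_bounded_above[of B "\<lambda>b. g (ifs_map R b x)" 1] N
    by (simp add: T_def N_def field_simps)
  have iter: "(c ^ n * L)-lipschitz_on UNIV ((T ^^ n) f) \<and> (\<forall>x. 0 \<le> (T ^^ n) f x \<and> (T ^^ n) f x \<le> 1)" for n
    using f T_lip T_bounds by (induction n) (auto simp: mult.assoc)
  have lim: "(\<lambda>n. (T ^^ n) f 0) \<longlonglongrightarrow> (\<integral>x. f x \<partial>\<rho>)" if \<rho>: "is_self_affine_measure R B \<rho>" for \<rho>
  proof -
    interpret prob_space \<rho> using \<rho> by (simp add: is_self_affine_measure_def)
    have [measurable_cong]: "sets \<rho> = sets borel" using \<rho> by (auto simp: is_self_affine_measure_def)
    have meas [measurable]: "(T ^^ n) f \<in> borel_measurable borel" for n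
      using iter[of n] lipschitz_on_borel_measurable by blast
    have int: "(\<integral>x. (T ^^ n) f x \<partial>\<rho>) = (\<integral>x. f x \<partial>\<rho>)" for n
    proof (induction n)
      case (Suc n)
      have "(\<integral>x. (T ^^ n) f x \<partial>\<rho>) = (\<integral>x. (T ^^ Suc n) f x \<partial>\<rho>)"
        using iter[of n] self_affine_measure_integral[OF \<rho> meas[of n]] by (simp add: T_def N_def)
      with Suc show ?case by simp
    qed simp
    \<comment> \<open>The Lipschitz bound below grows with \<open>norm x\<close>, and
      \<open>\<rho>\<close> is not known to have bounded support. Convergence is therefore only
      pointwise, and the constant 1 dominates because all iterates take values in [0, 1].\<close>
    have "(\<lambda>n. \<integral>x. (T ^^ n) f x - (T ^^ n) f 0 \<partial>\<rho>) \<longlonglongrightarrow> (\<integral>x. 0 \<partial>\<rho>)"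
    proof (rule integral_dominated_convergence[where w = "\<lambda>_. 1"])
      show "AE x in \<rho>. (\<lambda>n. (T ^^ n) f x - (T ^^ n) f 0) \<longlonglongrightarrow> 0"
      proof (rule AE_I2, rule Lim_null_comparison)
        fix x
        show "eventually (\<lambda>n. norm ((T ^^ n) f x - (T ^^ n) f 0) \<le> c ^ n * L * norm x) sequentially"
          using lipschitz_onD[OF iter[THEN conjunct1], of x 0]
          by (intro always_eventually) (simp add: dist_norm)
        show "(\<lambda>n. c ^ n * L * norm x) \<longlonglongrightarrow> 0"
          using c by (intro tendsto_mult_left_zero LIMSEQ_power_zero) simp
      qed
      have "\<bar>(T ^^ n) f x - (T ^^ n) f 0\<bar> \<le> 1" for n x
        using iter[of n] by (smt (verit))
      then show "AE x in \<rho>. norm ((T ^^ n) f x - (T ^^ n) f 0) \<le> 1" for n by simp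
    qed auto
    moreover have "integrable \<rho> ((T ^^ n) f)" for n
      using iter[of n] by (intro integrable_const_bound[where B = 1]) auto
    ultimately have "(\<lambda>n. (\<integral>x. f x \<partial>\<rho>) - (T ^^ n) f 0) \<longlonglongrightarrow> 0"
      by (simp add: int prob_space)
    from tendsto_diff[OF tendsto_const[of "\<integral>x. f x \<partial>\<rho>"] this] show ?thesis by simp
  qed
  show "(\<integral>x. f x \<partial>\<mu>) = (\<integral>x. f x \<partial>\<nu>)"
    using lim[OF \<mu>] lim[OF \<nu>] by (rule LIMSEQ_unique)
qed

section \<open>The measure on the segment\<close>

text \<open>A density on the whole line, so that functions on all reals can be integrated without
  restriction. The open interval avoids the endpoints, which the map to the circle would
  identify.\<close>

definition unit_interval_measure :: "real measure" where
  "unit_interval_measure = density lborel (indicator {0<..<1})"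

lemma sets_unit_interval_measure [simp, measurable_cong]:
  "sets unit_interval_measure = sets borel"
  by (simp add: unit_interval_measure_def)

lemma space_unit_interval_measure [simp]: "space unit_interval_measure = UNIV"
  by (simp add: unit_interval_measure_def)

lemma nn_integral_unit_interval_measure:
  "f \<in> borel_measurable borel \<Longrightarrow>
    (\<integral>\<^sup>+x. f x \<partial>unit_interval_measure) = (\<integral>\<^sup>+x. indicator {0<..<1} x * f x \<partial>lborel)"
  unfolding unit_interval_measure_def by (subst nn_integral_density) auto

lemma AE_unit_interval_measure: "AE x in unit_interval_measure. 0 < x \<and> x < 1"
  unfolding unit_interval_measure_def by (subst AE_density) (auto simp: indicator_def)

lemma prob_space_unit_interval_measure: "prob_space unit_interval_measure"
proof
  have "emeasure unit_interval_measure UNIV = (\<integral>\<^sup>+x. 1 \<partial>unit_interval_measure)"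
    by simp
  also have "\<dots> = (\<integral>\<^sup>+x. indicator {0<..<1::real} x \<partial>lborel)"
    by (subst nn_integral_unit_interval_measure) auto
  also have "\<dots> = 1"
    by (subst nn_integral_indicator) auto
  finally show "emeasure unit_interval_measure (space unit_interval_measure) = 1"
    by simp
qed

text \<open>The invariance equation in one dimension: x / 2 and (x + 1) / 2 are the two maps of the
  system on the horizontal axis. The interval is cut at the null point 1/2 and each half is
  rescaled.\<close>

lemma nn_integral_unit_interval_halves:
  assumes [measurable]: "f \<in> borel_measurable borel"
  shows "(\<integral>\<^sup>+x. f x \<partial>unit_interval_measure) =
    ennreal (1/2) * (\<integral>\<^sup>+x. f (x / 2) \<partial>unit_interval_measure) +
    ennreal (1/2) * (\<integral>\<^sup>+x. f ((x + 1) / 2) \<partial>unit_interval_measure)"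
proof -
  have "(\<integral>\<^sup>+x. f x \<partial>unit_interval_measure) = (\<integral>\<^sup>+x. indicator {0<..<1} x * f x \<partial>lborel)"
    by (simp add: nn_integral_unit_interval_measure)
  also have "\<dots> = (\<integral>\<^sup>+x. indicator {0<..<1/2} x * f x + indicator {1/2<..<1} x * f x \<partial>lborel)"
    using AE_lborel_singleton[of "1/2::real"]
    by (intro nn_integral_cong_AE, eventually_elim) (auto simp: indicator_def)
  also have "\<dots> = (\<integral>\<^sup>+x. indicator {0<..<1/2} x * f x \<partial>lborel) + (\<integral>\<^sup>+x. indicator {1/2<..<1} x * f x \<partial>lborel)"
    by (rule nn_integral_add) auto
  also have "(\<integral>\<^sup>+x. indicator {0<..<1/2} x * f x \<partial>lborel) =
      ennreal (1/2) * (\<integral>\<^sup>+x. indicator {0<..<1} x * f (x / 2) \<partial>lborel)"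
    by (subst nn_integral_real_affine[where c = "1/2" and t = 0])
      (auto simp: indicator_def intro!: arg_cong2[where f = "(*)"] nn_integral_cong)
  also have "(\<integral>\<^sup>+x. indicator {1/2<..<1} x * f x \<partial>lborel) =
      ennreal (1/2) * (\<integral>\<^sup>+x. indicator {0<..<1} x * f ((x + 1) / 2) \<partial>lborel)"
    by (subst nn_integral_real_affine[where c = "1/2" and t = "1/2"])
      (auto simp: indicator_def field_simps intro!: arg_cong2[where f = "(*)"] nn_integral_cong)
  finally show ?thesis
    by (simp add: nn_integral_unit_interval_measure)
qed

definition segment_measure :: "(real^2) measure" where
  "segment_measure = distr unit_interval_measure borel (\<lambda>x. x *\<^sub>R axis 1 1)"

lemma sets_segment_measure [simp, measurable_cong]: "sets segment_measure = sets borel"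
  by (simp add: segment_measure_def)

lemma prob_space_segment_measure: "prob_space segment_measure"
  unfolding segment_measure_def
  by (rule prob_space.prob_space_distr[OF prob_space_unit_interval_measure]) simp

section \<open>The inverse shear matrix and the identification of the measure\<close>

lemma matrix_inv_eqI:
  fixes A C :: "real^'n^'n"
  assumes "A ** C = mat 1"
  shows "matrix_inv A = C"
proof -
  have "A ** matrix_inv A = mat 1 \<and> matrix_inv A ** A = mat 1"
    unfolding matrix_inv_def
    by (rule someI[of _ C]) (use assms matrix_left_right_inverse[of A C] in simp)
  then show ?thesis
    using assms by (metis matrix_mul_assoc matrix_mul_lid matrix_mul_rid)
qed

lemma matrix_inv_shear:
  assumes R: "R = (vector [vector [2, 1], vector [0, 2]] :: real^2^2)"
  shows "matrix_inv R = vector [vector [1/2, -1/4], vector [0, 1/2]]"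
  by (rule matrix_inv_eqI)
    (simp add: R vec_eq_iff forall_2 matrix_matrix_mult_def mat_def sum_2)

text \<open>In this form the second term vanishes on the horizontal axis, where the map is plain
  halving, and the triangle inequality gives the contraction constant 1/2 + 1/4.\<close>

lemma matrix_inv_shear_mult:
  assumes "R = (vector [vector [2, 1], vector [0, 2]] :: real^2^2)"
  shows "matrix_inv R *v v = (1/2) *\<^sub>R v + (- v$2 / 4) *\<^sub>R axis 1 1"
  by (simp add: matrix_inv_shear[OF assms] vec_eq_iff forall_2 matrix_vector_mult_def sum_2 axis_def)

lemma norm_matrix_inv_shear:
  assumes "R = (vector [vector [2, 1], vector [0, 2]] :: real^2^2)"
  shows "norm (matrix_inv R *v v) \<le> 3/4 * norm v"
proof -
  have "norm (matrix_inv R *v v) \<le> norm ((1/2) *\<^sub>R v) + norm ((- v$2 / 4) *\<^sub>R (axis 1 1 :: real^2))"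
    unfolding matrix_inv_shear_mult[OF assms] by (rule norm_triangle_ineq)
  also have "\<dots> = norm v / 2 + \<bar>v$2\<bar> / 4"
    by simp
  finally show ?thesis using component_le_norm_cart[of v 2] by simp
qed

lemma self_affine_measure_shear:
  assumes R: "R = (vector [vector [2, 1], vector [0, 2]] :: real^2^2)"
    and B: "B = {vector [0, 0], vector [1, 0]}"
  shows "self_affine_measure R B = segment_measure"
proof -
  have ifs: "ifs_map R (vector [b, 0]) (x *\<^sub>R axis 1 1) = ((x + b) / 2) *\<^sub>R axis 1 1" for b x
    by (simp add: ifs_map_def matrix_inv_shear_mult[OF R] vec_eq_iff forall_2 axis_def)
  \<comment> \<open>Ensures that \<open>card B\<close> is 2 and that the sum over \<open>B\<close>
    has two terms.\<close>
  have neq: "(vector [0, 0] :: real^2) \<noteq> vector [1, 0]"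
    by (simp add: vec_eq_iff forall_2)
  interpret prob_space segment_measure by (rule prob_space_segment_measure)
  have invariant: "measure segment_measure E = (\<Sum>b\<in>B. 1 / real (card B) * measure segment_measure (ifs_map R b -` E))"
    if [measurable]: "E \<in> sets borel" for E
  proof -
    define F :: "real \<Rightarrow> ennreal" where "F x = indicator E (x *\<^sub>R axis 1 1)" for x
    have [measurable]: "F \<in> borel_measurable borel" unfolding F_def by measurable
    have em: "emeasure segment_measure G = (\<integral>\<^sup>+x. indicator G (x *\<^sub>R axis 1 1) \<partial>unit_interval_measure)"
      if [measurable]: "G \<in> sets borel" for G
      unfolding segment_measure_def
      by (subst nn_integral_indicator[symmetric], simp, subst nn_integral_distr) auto
    have em_ifs: "emeasure segment_measure (ifs_map R (vector [b, 0]) -` E) =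
        (\<integral>\<^sup>+x. F ((x + b) / 2) \<partial>unit_interval_measure)" for b
      using measurable_sets[OF borel_measurable_ifs_map that, of R "vector [b, 0]"]
      by (subst em) (auto simp: F_def ifs indicator_def intro!: nn_integral_cong)
    have "emeasure segment_measure E =
        ennreal (1/2) * emeasure segment_measure (ifs_map R (vector [0, 0]) -` E) +
        ennreal (1/2) * emeasure segment_measure (ifs_map R (vector [1, 0]) -` E)"
      using nn_integral_unit_interval_halves[of F] by (simp add: em_ifs em F_def)
    then show ?thesis
      unfolding emeasure_eq_measure
      by (subst (asm) ennreal_mult[symmetric], simp, simp, subst (asm) ennreal_mult[symmetric], simp, simp)
        (simp add: B neq flip: ennreal_plus)
  qed
  have sa: "is_self_affine_measure R B segment_measure"
    unfolding is_self_affine_measure_def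
    using invariant prob_space_segment_measure by simp
  show ?thesis
    unfolding self_affine_measure_def
  proof (rule the_equality)
    show "is_self_affine_measure R B segment_measure" by (rule sa)
    show "\<mu> = segment_measure" if "is_self_affine_measure R B \<mu>" for \<mu>
      by (rule is_self_affine_measure_unique[OF that sa, where c = "3/4"])
        (use norm_matrix_inv_shear[OF R] in \<open>auto simp: B\<close>)
  qed
qed

section \<open>Fourier series on the unit interval\<close>

text \<open>Frequencies may repeat in a sum; this makes closure under products a plain induction.
  \<open>trig_poly_eq_sum\<close> later merges equal frequencies, because completeness asks for one
  coefficient per frequency.\<close>

inductive trig_poly :: "(real \<Rightarrow> complex) \<Rightarrow> bool" where
  monomial: "trig_poly (\<lambda>x. c * exponential (of_int n) x)"
| add: "trig_poly S \<Longrightarrow> trig_poly T \<Longrightarrow> trig_poly (\<lambda>x. S x + T x)"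

lemma exponential_of_int_eq_cis: "exponential (real_of_int n) x = cis (- 2 * pi * of_int n * x)"
  by (simp add: exponential_def cis_conv_exp mult_ac)

lemma norm_exponential [simp]: "cmod (exponential \<xi> x) = 1"
  by (simp add: exponential_def norm_exp_eq_Re)

lemma continuous_on_exponential [continuous_intros]: "continuous_on A (exponential \<xi>)"
  unfolding exponential_def by (intro continuous_intros)

lemma borel_measurable_exponential [measurable]:
  fixes \<xi> :: "'a::euclidean_space"
  shows "exponential \<xi> \<in> borel_measurable borel"
  by (intro borel_measurable_continuous_onI continuous_intros)

lemma trig_poly_const: "trig_poly (\<lambda>x. c)"
  using trig_poly.monomial[of c 0] by (simp add: exponential_def)

lemma trig_poly_monomial_mult:
  assumes "trig_poly T"
  shows "trig_poly (\<lambda>x. c * exponential (of_int n) x * T x)"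
  using assms
proof induction
  case (monomial d m)
  have "c * exponential (of_int n) x * (d * exponential (of_int m) x) =
      c * d * exponential (of_int (n + m)) x" for x :: real
    unfolding exponential_of_int_eq_cis by (simp add: cis_mult algebra_simps)
  then show ?case using trig_poly.monomial[of "c * d" "n + m"] by (simp only:)
next
  case (add S T)
  then show ?case using trig_poly.add by (simp add: distrib_left)
qed

lemma trig_poly_mult: "trig_poly S \<Longrightarrow> trig_poly T \<Longrightarrow> trig_poly (\<lambda>x. S x * T x)"
  by (induction S rule: trig_poly.induct)
    (auto simp: distrib_right intro: trig_poly_monomial_mult trig_poly.add)

lemma trig_poly_eq_sum:
  assumes "trig_poly T"
  shows "\<exists>J c. finite J \<and> T = (\<lambda>x. \<Sum>n\<in>J. c n * exponential (of_int n) x)"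
  using assms
proof induction
  case (monomial c n)
  show ?case by (intro exI[of _ "{n}"] exI[of _ "\<lambda>_. c"]) simp
next
  case (add S T)
  then obtain J c K d where J: "finite J" "S = (\<lambda>x. \<Sum>n\<in>J. c n * exponential (of_int n) x)"
    and K: "finite K" "T = (\<lambda>x. \<Sum>n\<in>K. d n * exponential (of_int n) x)"
    by blast
  define c' where "c' n = (if n \<in> J then c n else 0) + (if n \<in> K then d n else 0)" for n
  have "S x + T x = (\<Sum>n\<in>J \<union> K. c' n * exponential (of_int n) x)" for x
  proof -
    have "S x = (\<Sum>n\<in>J \<union> K. (if n \<in> J then c n else 0) * exponential (of_int n) x)"
      unfolding J(2) using J K by (intro sum.mono_neutral_cong_left) auto
    moreover have "T x = (\<Sum>n\<in>J \<union> K. (if n \<in> K then d n else 0) * exponential (of_int n) x)"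
      unfolding K(2) using J K by (intro sum.mono_neutral_cong_left) auto
    ultimately show ?thesis by (simp add: c'_def distrib_right sum.distrib)
  qed
  then show ?case using J K by (intro exI[of _ "J \<union> K"] exI[of _ c']) auto
qed

lemma borel_measurable_trig_poly: "trig_poly T \<Longrightarrow> T \<in> borel_measurable borel"
  by (induction rule: trig_poly.induct) simp_all

text \<open>Real polynomial functions are generated by linear forms, and a linear form on the circle
  is a combination of cosine and sine.\<close>

lemma trig_poly_circle:
  fixes p :: "complex \<Rightarrow> real"
  assumes "real_polynomial_function p"
  shows "trig_poly (\<lambda>x. of_real (p (cis (2 * pi * x))))"
  using assms
proof induction
  case (linear h)
  interpret bounded_linear h by fact
  define a b where "a = complex_of_real (h 1)" and "b = complex_of_real (h \<i>)"
  \<comment> \<open>Euler's formulas. As \<open>exponential (of_int 1) x\<close> is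
    \<open>cis (- 2 * pi * x)\<close>, the plus sign belongs to frequency 1.\<close>
  have "of_real (h (cis (2 * pi * x))) =
      (a / 2 + \<i> * b / 2) * exponential (of_int 1) x + (a / 2 - \<i> * b / 2) * exponential (of_int (-1)) x" for x
  proof -
    have "h (cis (2 * pi * x)) = h (cos (2 * pi * x) *\<^sub>R 1 + sin (2 * pi * x) *\<^sub>R \<i>)"
      by (rule arg_cong[of _ _ h]) (simp add: complex_eq_iff)
    also have "\<dots> = cos (2 * pi * x) * h 1 + sin (2 * pi * x) * h \<i>"
      by (simp add: add scaleR)
    finally show ?thesis
      unfolding exponential_of_int_eq_cis by (simp add: complex_eq_iff a_def b_def)
  qed
  then show ?case
    using trig_poly.add[OF trig_poly.monomial[of _ 1] trig_poly.monomial[of _ "-1"]] by simp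
qed (auto intro: trig_poly_const trig_poly.add trig_poly_mult)

section \<open>Approximation in the mean by trigonometric polynomials\<close>

text \<open>The squared distance is a nonnegative integral, so no integrability has to be carried
  through the closure properties. Note that \<epsilon> bounds the square of the norm.\<close>

definition trig_approximable :: "(real \<Rightarrow> complex) \<Rightarrow> bool" where
  "trig_approximable f \<longleftrightarrow> f \<in> borel_measurable borel \<and>
    (\<forall>\<epsilon>>0. \<exists>T. trig_poly T \<and> (\<integral>\<^sup>+x. ennreal ((cmod (f x - T x))\<^sup>2) \<partial>unit_interval_measure) < ennreal \<epsilon>)"

lemma trig_approximable_measurable: "trig_approximable f \<Longrightarrow> f \<in> borel_measurable borel"
  by (simp add: trig_approximable_def)

lemma trig_approximable_trig_poly: "trig_poly T \<Longrightarrow> trig_approximable T"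
  unfolding trig_approximable_def using borel_measurable_trig_poly by (auto intro!: exI[of _ T])

text \<open>A substitute for the triangle inequality in L2: since (a + b)^2 is at most 2 a^2 + 2
  b^2, two errors below \<epsilon> / 4 add up to less than \<epsilon>.\<close>

lemma nn_integral_sq_norm_add_less:
  fixes u v :: "'a \<Rightarrow> 'b::{real_normed_vector, second_countable_topology}"
  assumes [measurable]: "u \<in> borel_measurable M" "v \<in> borel_measurable M"
    and u: "(\<integral>\<^sup>+x. ennreal ((norm (u x))\<^sup>2) \<partial>M) < ennreal (\<epsilon> / 4)"
    and v: "(\<integral>\<^sup>+x. ennreal ((norm (v x))\<^sup>2) \<partial>M) < ennreal (\<epsilon> / 4)"
  shows "(\<integral>\<^sup>+x. ennreal ((norm (u x + v x))\<^sup>2) \<partial>M) < ennreal \<epsilon>"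
proof -
  have sq: "(norm (u x + v x))\<^sup>2 \<le> 2 * (norm (u x))\<^sup>2 + 2 * (norm (v x))\<^sup>2" for x
  proof -
    have "(norm (u x + v x))\<^sup>2 \<le> (norm (u x) + norm (v x))\<^sup>2"
      by (intro power_mono norm_triangle_ineq norm_ge_zero)
    also have "\<dots> \<le> 2 * (norm (u x))\<^sup>2 + 2 * (norm (v x))\<^sup>2"
      using sum_squares_bound[of "norm (u x)" "norm (v x)"] by (simp add: power2_sum)
    finally show ?thesis .
  qed
  have "(\<integral>\<^sup>+x. ennreal ((norm (u x + v x))\<^sup>2) \<partial>M) \<le>
      (\<integral>\<^sup>+x. 2 * ennreal ((norm (u x))\<^sup>2) + 2 * ennreal ((norm (v x))\<^sup>2) \<partial>M)"
  proof (intro nn_integral_mono)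
    fix x
    have "2 * ennreal ((norm (u x))\<^sup>2) + 2 * ennreal ((norm (v x))\<^sup>2) =
        ennreal (2 * (norm (u x))\<^sup>2 + 2 * (norm (v x))\<^sup>2)"
      by (simp add: ennreal_plus ennreal_mult)
    then show "ennreal ((norm (u x + v x))\<^sup>2) \<le> 2 * ennreal ((norm (u x))\<^sup>2) + 2 * ennreal ((norm (v x))\<^sup>2)"
      using sq[of x] by (metis ennreal_leI)
  qed
  also have "\<dots> = 2 * (\<integral>\<^sup>+x. ennreal ((norm (u x))\<^sup>2) \<partial>M) + 2 * (\<integral>\<^sup>+x. ennreal ((norm (v x))\<^sup>2) \<partial>M)"
    by (simp add: nn_integral_add nn_integral_cmult)
  also have "\<dots> < ennreal \<epsilon>"
  proof -
    obtain a where a: "(\<integral>\<^sup>+x. ennreal ((norm (u x))\<^sup>2) \<partial>M) = ennreal a" "a \<ge> 0"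
      using u by (cases "\<integral>\<^sup>+x. ennreal ((norm (u x))\<^sup>2) \<partial>M") auto
    obtain b where b: "(\<integral>\<^sup>+x. ennreal ((norm (v x))\<^sup>2) \<partial>M) = ennreal b" "b \<ge> 0"
      using v by (cases "\<integral>\<^sup>+x. ennreal ((norm (v x))\<^sup>2) \<partial>M") auto
    have "2 * a + 2 * b < \<epsilon>" using u v a b by (simp add: ennreal_less_iff)
    moreover have "2 * ennreal a + 2 * ennreal b = ennreal (2 * a + 2 * b)"
      using a b by (simp add: ennreal_plus ennreal_mult)
    ultimately show ?thesis
      unfolding a(1) b(1) using a b by (simp add: ennreal_less_iff del: ennreal_plus)
  qed
  finally show ?thesis .
qed

lemma trig_approximable_add:
  assumes "trig_approximable f" "trig_approximable g"
  shows "trig_approximable (\<lambda>x. f x + g x)"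
  unfolding trig_approximable_def
proof (intro conjI allI impI)
  note [measurable] = assms[THEN trig_approximable_measurable] and [measurable] = borel_measurable_trig_poly
  show "(\<lambda>x. f x + g x) \<in> borel_measurable borel" by simp
  fix \<epsilon> :: real assume "\<epsilon> > 0"
  then have "\<epsilon> / 4 > 0" by simp
  with assms obtain S T where S: "trig_poly S" "(\<integral>\<^sup>+x. ennreal ((cmod (f x - S x))\<^sup>2) \<partial>unit_interval_measure) < ennreal (\<epsilon> / 4)"
    and T: "trig_poly T" "(\<integral>\<^sup>+x. ennreal ((cmod (g x - T x))\<^sup>2) \<partial>unit_interval_measure) < ennreal (\<epsilon> / 4)"
    unfolding trig_approximable_def by blast
  have "(\<integral>\<^sup>+x. ennreal ((cmod ((f x - S x) + (g x - T x)))\<^sup>2) \<partial>unit_interval_measure) < ennreal \<epsilon>"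
    using S T by (intro nn_integral_sq_norm_add_less) auto
  then show "\<exists>T. trig_poly T \<and> (\<integral>\<^sup>+x. ennreal ((cmod (f x + g x - T x))\<^sup>2) \<partial>unit_interval_measure) < ennreal \<epsilon>"
    using trig_poly.add[OF S(1) T(1)] by (intro exI[of _ "\<lambda>x. S x + T x"]) (simp add: algebra_simps)
qed

lemma trig_approximable_limit:
  assumes [measurable]: "f \<in> borel_measurable borel"
    and lim: "\<And>\<epsilon>. \<epsilon> > 0 \<Longrightarrow> \<exists>g. trig_approximable g \<and>
      (\<integral>\<^sup>+x. ennreal ((cmod (f x - g x))\<^sup>2) \<partial>unit_interval_measure) < ennreal \<epsilon>"
  shows "trig_approximable f"
  unfolding trig_approximable_def
proof (intro conjI allI impI)
  show "f \<in> borel_measurable borel" by fact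
  fix \<epsilon> :: real assume "\<epsilon> > 0"
  then have "\<epsilon> / 4 > 0" by simp
  then obtain g where g: "trig_approximable g"
    "(\<integral>\<^sup>+x. ennreal ((cmod (f x - g x))\<^sup>2) \<partial>unit_interval_measure) < ennreal (\<epsilon> / 4)"
    using lim by blast
  then obtain T where T: "trig_poly T"
    "(\<integral>\<^sup>+x. ennreal ((cmod (g x - T x))\<^sup>2) \<partial>unit_interval_measure) < ennreal (\<epsilon> / 4)"
    using \<open>\<epsilon> / 4 > 0\<close> unfolding trig_approximable_def by blast
  note [measurable] = trig_approximable_measurable[OF g(1)] borel_measurable_trig_poly[OF T(1)]
  have "(\<integral>\<^sup>+x. ennreal ((cmod ((f x - g x) + (g x - T x)))\<^sup>2) \<partial>unit_interval_measure) < ennreal \<epsilon>"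
    using g T by (intro nn_integral_sq_norm_add_less) auto
  then show "\<exists>T. trig_poly T \<and> (\<integral>\<^sup>+x. ennreal ((cmod (f x - T x))\<^sup>2) \<partial>unit_interval_measure) < ennreal \<epsilon>"
    using T by auto
qed

lemma trig_approximable_uniform_limit:
  assumes "f \<in> borel_measurable borel"
    and unif: "\<And>\<epsilon>. \<epsilon> > 0 \<Longrightarrow> \<exists>g. trig_approximable g \<and> (\<forall>x. cmod (f x - g x) < \<epsilon>)"
  shows "trig_approximable f"
proof (rule trig_approximable_limit)
  fix \<epsilon> :: real assume "\<epsilon> > 0"
  \<comment> \<open>Integration yields only a weak inequality; \<epsilon> / 2 leaves room for the
    strict one.\<close>
  then have "sqrt (\<epsilon> / 2) > 0" by simp
  then obtain g where g: "trig_approximable g" "\<And>x. cmod (f x - g x) < sqrt (\<epsilon> / 2)"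
    using unif by blast
  interpret prob_space unit_interval_measure by (rule prob_space_unit_interval_measure)
  have "(cmod (f x - g x))\<^sup>2 \<le> \<epsilon> / 2" for x
    using power_mono[OF less_imp_le[OF g(2)[of x]], of 2] \<open>\<epsilon> > 0\<close> by simp
  then have "(\<integral>\<^sup>+x. ennreal ((cmod (f x - g x))\<^sup>2) \<partial>unit_interval_measure) \<le>
      (\<integral>\<^sup>+x. ennreal (\<epsilon> / 2) \<partial>unit_interval_measure)"
    by (intro nn_integral_mono ennreal_leI)
  also have "\<dots> = ennreal (\<epsilon> / 2)" using emeasure_space_1 by simp
  also have "\<dots> < ennreal \<epsilon>" using \<open>\<epsilon> > 0\<close> by (simp add: ennreal_less_iff)
  finally show "\<exists>g. trig_approximable g \<and>
      (\<integral>\<^sup>+x. ennreal ((cmod (f x - g x))\<^sup>2) \<partial>unit_interval_measure) < ennreal \<epsilon>"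
    using g by blast
qed fact

text \<open>The dominating function may vary with x, because the final passage to unbounded
  functions uses a multiple of \<open>cmod (f x)\<close>. Both f and the approximants are below
  \<open>w\<close>, whence the bound 4 w^2 on the squared differences.\<close>

lemma trig_approximable_dominated:
  assumes f [measurable]: "f \<in> borel_measurable borel" and g: "\<And>i. trig_approximable (g i)"
    and lim: "AE x in unit_interval_measure. (\<lambda>i. g i x) \<longlonglongrightarrow> f x"
    and w: "w \<in> borel_measurable borel" "(\<integral>\<^sup>+x. ennreal ((w x)\<^sup>2) \<partial>unit_interval_measure) < \<infinity>"
    and bound: "\<And>i x. cmod (g i x) \<le> w x" "\<And>x. cmod (f x) \<le> w x"
  shows "trig_approximable f"
proof (rule trig_approximable_limit[OF f])
  note [measurable] = g[THEN trig_approximable_measurable] w(1)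
  fix \<epsilon> :: real assume "\<epsilon> > 0"
  have "(\<lambda>i. \<integral>\<^sup>+x. ennreal ((cmod (f x - g i x))\<^sup>2) \<partial>unit_interval_measure) \<longlonglongrightarrow>
      (\<integral>\<^sup>+x. 0 \<partial>unit_interval_measure)"
  proof (rule nn_integral_dominated_convergence[where w = "\<lambda>x. 4 * ennreal ((w x)\<^sup>2)"])
    show "AE x in unit_interval_measure. ennreal ((cmod (f x - g i x))\<^sup>2) \<le> 4 * ennreal ((w x)\<^sup>2)" for i
    proof (rule AE_I2)
      fix x
      have "cmod (f x - g i x) \<le> 2 * w x"
        using norm_triangle_ineq4[of "f x" "g i x"] bound(1)[of i x] bound(2)[of x] by linarith
      then have "(cmod (f x - g i x))\<^sup>2 \<le> (2 * w x)\<^sup>2" by (rule power_mono) simp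
      then have "ennreal ((cmod (f x - g i x))\<^sup>2) \<le> ennreal (4 * (w x)\<^sup>2)"
        by (intro ennreal_leI) (simp add: power_mult_distrib)
      then show "ennreal ((cmod (f x - g i x))\<^sup>2) \<le> 4 * ennreal ((w x)\<^sup>2)"
        by (simp add: ennreal_mult)
    qed
    show "(\<integral>\<^sup>+x. 4 * ennreal ((w x)\<^sup>2) \<partial>unit_interval_measure) < \<infinity>"
      using w(2) by (simp add: nn_integral_cmult ennreal_mult_less_top)
    show "AE x in unit_interval_measure. (\<lambda>i. ennreal ((cmod (f x - g i x))\<^sup>2)) \<longlonglongrightarrow> 0"
      using lim
    proof eventually_elim
      case (elim x)
      have "(\<lambda>i. (cmod (f x - g i x))\<^sup>2) \<longlonglongrightarrow> (cmod (f x - f x))\<^sup>2"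
        by (intro tendsto_intros elim)
      then show ?case using tendsto_ennrealI by fastforce
    qed
  qed auto
  then have "eventually (\<lambda>i. (\<integral>\<^sup>+x. ennreal ((cmod (f x - g i x))\<^sup>2) \<partial>unit_interval_measure) < ennreal \<epsilon>) sequentially"
    using \<open>\<epsilon> > 0\<close> by (intro order_tendstoD) auto
  then show "\<exists>g. trig_approximable g \<and>
      (\<integral>\<^sup>+x. ennreal ((cmod (f x - g x))\<^sup>2) \<partial>unit_interval_measure) < ennreal \<epsilon>"
    using g by (auto simp: eventually_sequentially)
qed

lemma trig_approximable_dominated_const:
  assumes "f \<in> borel_measurable borel" "\<And>i. trig_approximable (g i)"
    "AE x in unit_interval_measure. (\<lambda>i. g i x) \<longlonglongrightarrow> f x"
    "\<And>i x. cmod (g i x) \<le> K" "\<And>x. cmod (f x) \<le> K"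
  shows "trig_approximable f"
proof (rule trig_approximable_dominated[where w = "\<lambda>_. K"])
  interpret prob_space unit_interval_measure by (rule prob_space_unit_interval_measure)
  show "(\<integral>\<^sup>+x. ennreal (K\<^sup>2) \<partial>unit_interval_measure) < \<infinity>"
    using emeasure_space_1 by simp
qed (use assms in auto)

lemma trig_approximable_cmult:
  assumes "trig_approximable f"
  shows "trig_approximable (\<lambda>x. c * f x)"
proof (cases "c = 0")
  case True
  then show ?thesis using trig_approximable_trig_poly[OF trig_poly_const[of 0]] by simp
next
  case False
  note [measurable] = trig_approximable_measurable[OF assms]
  show ?thesis
  proof (rule trig_approximable_limit)
    fix \<epsilon> :: real assume "\<epsilon> > 0"
    then have "\<epsilon> / (cmod c)\<^sup>2 > 0" using False by simp
    then obtain T where T: "trig_poly T"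
      "(\<integral>\<^sup>+x. ennreal ((cmod (f x - T x))\<^sup>2) \<partial>unit_interval_measure) < ennreal (\<epsilon> / (cmod c)\<^sup>2)"
      using assms unfolding trig_approximable_def by blast
    note [measurable] = borel_measurable_trig_poly[OF T(1)]
    have "(\<integral>\<^sup>+x. ennreal ((cmod (c * f x - c * T x))\<^sup>2) \<partial>unit_interval_measure) =
        (\<integral>\<^sup>+x. ennreal ((cmod c)\<^sup>2) * ennreal ((cmod (f x - T x))\<^sup>2) \<partial>unit_interval_measure)"
      by (simp add: norm_mult power_mult_distrib flip: right_diff_distrib ennreal_mult)
    also have "\<dots> = ennreal ((cmod c)\<^sup>2) * (\<integral>\<^sup>+x. ennreal ((cmod (f x - T x))\<^sup>2) \<partial>unit_interval_measure)"
      by (rule nn_integral_cmult) simp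
    also have "\<dots> < ennreal ((cmod c)\<^sup>2) * ennreal (\<epsilon> / (cmod c)\<^sup>2)"
      using T(2) False by (intro ennreal_mult_strict_left_mono) auto
    also have "\<dots> = ennreal \<epsilon>"
      using False \<open>\<epsilon> > 0\<close> by (simp flip: ennreal_mult)
    finally show "\<exists>g. trig_approximable g \<and>
        (\<integral>\<^sup>+x. ennreal ((cmod (c * f x - g x))\<^sup>2) \<partial>unit_interval_measure) < ennreal \<epsilon>"
      using trig_approximable_trig_poly[OF trig_poly_mult[OF trig_poly_const[of c] T(1)]] by blast
  qed simp
qed

lemma trig_approximable_sum:
  assumes "\<And>i. i \<in> I \<Longrightarrow> trig_approximable (f i)"
  shows "trig_approximable (\<lambda>x. \<Sum>i\<in>I. f i x)"
proof (cases "finite I")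
  case True
  then show ?thesis using assms
    by (induction I rule: finite_induct)
      (auto intro: trig_approximable_add trig_approximable_trig_poly trig_poly_const)
qed (auto intro: trig_approximable_trig_poly trig_poly_const)

section \<open>From continuous functions on the circle to all of L2\<close>

text \<open>Factoring through the circle builds in the periodicity that uniform approximation by
  trigonometric polynomials demands; the unit circle is compact, so Stone-Weierstrass
  applies.\<close>

lemma trig_approximable_continuous_circle:
  assumes "continuous_on UNIV (\<phi> :: complex \<Rightarrow> real)"
  shows "trig_approximable (\<lambda>x. of_real (\<phi> (cis (2 * pi * x))))"
proof (rule trig_approximable_uniform_limit)
  have "continuous_on UNIV (\<lambda>x. complex_of_real (\<phi> (cis (2 * pi * x))))"
    by (intro continuous_intros continuous_on_compose2[OF assms]) auto
  then show "(\<lambda>x. complex_of_real (\<phi> (cis (2 * pi * x)))) \<in> borel_measurable borel"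
    by (rule borel_measurable_continuous_onI)
  fix \<epsilon> :: real assume "\<epsilon> > 0"
  obtain p where p: "real_polynomial_function p" "\<And>z. z \<in> sphere 0 1 \<Longrightarrow> \<bar>\<phi> z - p z\<bar> < \<epsilon>"
    using Stone_Weierstrass_real_polynomial_function[of "sphere (0::complex) 1" \<phi> \<epsilon>]
      continuous_on_subset[OF assms] \<open>\<epsilon> > 0\<close> by auto
  have "cmod (of_real (\<phi> (cis (2 * pi * x))) - of_real (p (cis (2 * pi * x)))) < \<epsilon>" for x
    using p(2)[of "cis (2 * pi * x)"] by (simp flip: of_real_diff)
  then show "\<exists>g. trig_approximable g \<and> (\<forall>x. cmod (of_real (\<phi> (cis (2 * pi * x))) - g x) < \<epsilon>)"
    using trig_approximable_trig_poly[OF trig_poly_circle[OF p(1)]] by blast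
qed

lemma trig_approximable_closed_circle:
  assumes "closed (C :: complex set)"
  shows "trig_approximable (\<lambda>x. indicator C (cis (2 * pi * x)))"
proof -
  obtain \<phi> where \<phi>: "\<And>k. \<exists>L. L-lipschitz_on UNIV (\<phi> k)" "\<And>k x. 0 \<le> \<phi> k x"
      "\<And>k x. \<phi> k x \<le> (1::real)" "\<And>x. (\<lambda>k. \<phi> k x) \<longlonglongrightarrow> indicator C x"
    using closed_indicator_lipschitz_limit[OF assms] by metis
  have [measurable]: "C \<in> sets borel" using assms by simp
  have [measurable]: "(\<lambda>x. cis (2 * pi * x)) \<in> borel_measurable borel"
    by (intro borel_measurable_continuous_onI continuous_intros)
  show ?thesis
  proof (rule trig_approximable_dominated_const[where K = 1])
    show "trig_approximable (\<lambda>x. of_real (\<phi> k (cis (2 * pi * x))))" for k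
      using \<phi>(1)[of k] by (intro trig_approximable_continuous_circle) (auto dest: lipschitz_on_continuous_on)
    show "AE x in unit_interval_measure.
        (\<lambda>k. complex_of_real (\<phi> k (cis (2 * pi * x)))) \<longlonglongrightarrow> indicator C (cis (2 * pi * x))"
    proof (rule AE_I2)
      fix x
      show "(\<lambda>k. complex_of_real (\<phi> k (cis (2 * pi * x)))) \<longlonglongrightarrow> indicator C (cis (2 * pi * x))"
        using tendsto_of_real[OF \<phi>(4)[of "cis (2 * pi * x)"], where 'a = complex]
        by (cases "cis (2 * pi * x) \<in> C") simp_all
    qed
  qed (use \<phi> in \<open>auto simp: indicator_def\<close>)
qed

lemma inj_on_cis_unit_interval: "inj_on (\<lambda>x. cis (2 * pi * x)) {0<..<1}"
proof (rule inj_onI)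
  fix x y :: real
  assume xy: "x \<in> {0<..<1}" "y \<in> {0<..<1}" and eq: "cis (2 * pi * x) = cis (2 * pi * y)"
  have "cis (2 * pi * x - 2 * pi * y) = 1"
    using eq by (simp flip: cis_divide)
  then have "cos (2 * pi * (x - y)) = 1"
    by (simp add: complex_eq_iff right_diff_distrib)
  then obtain n :: int where "2 * pi * (x - y) = of_int n * 2 * pi"
    by (auto simp: cos_one_2pi_int)
  then have "x - y = of_int n" by simp
  moreover have "\<bar>x - y\<bar> < 1" using xy by auto
  ultimately have "n = 0" by linarith
  with \<open>x - y = of_int n\<close> show "x = y" by simp
qed

text \<open>Compact pieces of \<open>K\<close> inside (0, 1) have closed images on the circle, and
  injectivity there lets the images recover the pieces. The pieces exhaust \<open>K\<close> up to a
  null set.\<close>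

lemma trig_approximable_closed:
  assumes "closed K"
  shows "trig_approximable (indicator K)"
proof -
  \<comment> \<open>The margin is positive for every \<open>i\<close>, which keeps the pieces away
    from 0 and 1, both sent to the same point of the circle.\<close>
  define K' where "K' i = K \<inter> {1 / real (i + 2)..1 - 1 / real (i + 2)}" for i :: nat
  define C where "C i = (\<lambda>x. cis (2 * pi * x)) ` K' i" for i
  have sub: "K' i \<subseteq> {0<..<1}" for i
  proof -
    have pos: "0 < 1 / real (i + 2)" by simp
    show ?thesis
    proof
      fix x assume "x \<in> K' i"
      then have "1 / real (i + 2) \<le> x" "x \<le> 1 - 1 / real (i + 2)" by (auto simp: K'_def)
      with pos show "x \<in> {0<..<1}" unfolding greaterThanLessThan_iff by linarith
    qed
  qed
  have "compact (K' i)" for i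
    unfolding K'_def using assms by (rule closed_Int_compact) simp
  then have "closed (C i)" for i
    unfolding C_def by (intro compact_imp_closed compact_continuous_image continuous_intros)
  note C = trig_approximable_closed_circle[OF this]
  have mem: "cis (2 * pi * x) \<in> C i \<longleftrightarrow> x \<in> K' i" if "x \<in> {0<..<1}" for x i
    unfolding C_def using inj_on_image_mem_iff[OF inj_on_cis_unit_interval that sub] .
  have [measurable]: "K \<in> sets borel" using assms by simp
  show ?thesis
  proof (rule trig_approximable_dominated_const[OF _ C, where K = 1])
    show "AE x in unit_interval_measure. (\<lambda>i. indicator (C i) (cis (2 * pi * x))) \<longlonglongrightarrow> (indicator K x :: complex)"
      using AE_unit_interval_measure
    proof eventually_elim
      case (elim x)
      obtain i where i: "inverse (of_nat (Suc i)) < min x (1 - x)"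
        using reals_Archimedean[of "min x (1 - x)"] elim by auto
      have "(indicator (C j) (cis (2 * pi * x)) :: complex) = indicator K x" if "j \<ge> i" for j
      proof -
        have "1 / real (j + 2) \<le> inverse (of_nat (Suc i))"
          using that by (simp add: field_simps)
        with i have "x \<in> {1 / real (j + 2)..1 - 1 / real (j + 2)}" by auto
        then show ?thesis using mem[of x j] elim by (auto simp: K'_def indicator_def)
      qed
      then show ?case by (intro tendsto_eventually) (auto simp: eventually_sequentially)
    qed
  qed (auto simp: indicator_def)
qed

text \<open>Dynkin's argument, starting from the closed sets.\<close>

lemma trig_approximable_indicator:
  assumes "A \<in> sets borel"
  shows "trig_approximable (indicator A)"
proof -
  have "Int_stable (Collect closed :: real set set)" by (auto simp: Int_stable_def)
  moreover have "Collect closed \<subseteq> Pow (UNIV :: real set)" by simp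
  moreover have "A \<in> sigma_sets UNIV (Collect closed)"
    using assms by (simp add: borel_eq_closed)
  ultimately show ?thesis
  proof (induction rule: sigma_sets_induct_disjoint)
    case (basic A)
    then show ?case by (simp add: trig_approximable_closed)
  next
    case empty
    show ?case using trig_approximable_closed[of "{}"] by blast
  next
    case (compl A)
    have "indicator (UNIV - A) = (\<lambda>x. 1 + (-1) * indicator A x :: complex)"
      by (auto simp: indicator_def)
    then show ?case
      using trig_approximable_add[OF trig_approximable_trig_poly[OF trig_poly_const] trig_approximable_cmult[OF compl(2)]]
      by metis
  next
    case (union A)
    have meas [measurable]: "A i \<in> sets borel" for i
      using union(2) by (auto simp: borel_eq_closed)
    \<comment> \<open>Disjointness turns the partial sums into indicators, so the constant 1
      dominates them.\<close>
    have part: "(\<Sum>i<n. indicator (A i) x) = (indicator (\<Union>i<n. A i) x :: complex)" for n x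
      using union(1)
      by (subst indicator_UN_disjoint) (auto intro: disjoint_family_on_mono)
    show ?case
    proof (rule trig_approximable_dominated_const[where K = 1])
      show "trig_approximable (\<lambda>x. \<Sum>i<n. indicator (A i) x)" for n
        using union(3) by (intro trig_approximable_sum)
      show "AE x in unit_interval_measure. (\<lambda>n. \<Sum>i<n. indicator (A i) x) \<longlonglongrightarrow> (indicator (\<Union>i. A i) x :: complex)"
        unfolding part by (intro AE_I2 LIMSEQ_indicator_UN)
      show "cmod (\<Sum>i<n. indicator (A i) x) \<le> 1" for n x
        unfolding part by (simp add: indicator_def)
    qed (auto simp: indicator_def)
  qed
qed

text \<open>Simple functions converge to \<open>f\<close> pointwise while staying below
  \<open>2 * cmod (f x)\<close>, which is square integrable.\<close>

lemma trig_approximable_L2: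
  assumes [measurable]: "f \<in> borel_measurable borel"
    and fin: "(\<integral>\<^sup>+x. ennreal ((cmod (f x))\<^sup>2) \<partial>unit_interval_measure) < \<infinity>"
  shows "trig_approximable f"
proof -
  obtain F where F: "\<And>i. simple_function borel (F i)" "\<And>x. (\<lambda>i. F i x) \<longlonglongrightarrow> f x"
    "\<And>i x. cmod (F i x) \<le> 2 * cmod (f x)"
    using borel_measurable_implies_sequence_metric[OF assms(1), of 0] by (auto simp: dist_norm)
  show ?thesis
  proof (rule trig_approximable_dominated[where g = F and w = "\<lambda>x. 2 * cmod (f x)"])
    show "trig_approximable (F i)" for i
    proof -
      have [simp]: "complex_of_real (of_bool P) = of_bool P" for P
        by (cases P) simp_all
      have "F i = (\<lambda>x. \<Sum>y\<in>range (F i). y * indicator (F i -` {y}) x)"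
        using simple_function_indicator_representation_banach[OF F(1)[of i]]
        by (intro ext) (simp add: scaleR_conv_of_real indicator_def mult.commute)
      moreover have "trig_approximable (\<lambda>x. \<Sum>y\<in>range (F i). y * indicator (F i -` {y}) x)"
        using simple_functionD(2)[OF F(1)[of i]]
        by (intro trig_approximable_sum trig_approximable_cmult trig_approximable_indicator) auto
      ultimately show ?thesis by simp
    qed
    have "(\<integral>\<^sup>+x. ennreal ((2 * cmod (f x))\<^sup>2) \<partial>unit_interval_measure) =
        4 * (\<integral>\<^sup>+x. ennreal ((cmod (f x))\<^sup>2) \<partial>unit_interval_measure)"
      by (subst nn_integral_cmult[symmetric]) (auto simp: power_mult_distrib ennreal_mult)
    then show "(\<integral>\<^sup>+x. ennreal ((2 * cmod (f x))\<^sup>2) \<partial>unit_interval_measure) < \<infinity>"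
      using fin by (simp add: ennreal_mult_less_top)
  qed (use F in auto)
qed

section \<open>Orthogonality, and graphs over the integers as spectra\<close>

lemma exponential_mult_cnj: "exponential \<xi> x * cnj (exponential \<eta> x) = exponential (\<xi> - \<eta>) x"
proof -
  have "cnj (exponential \<eta> x) = exp (2 * of_real pi * \<i> * of_real (\<eta> \<bullet> x))"
    by (simp add: exponential_def exp_cnj)
  then show ?thesis
    by (simp add: exponential_def inner_diff_left algebra_simps flip: exp_add)
qed

text \<open>Passes to the gauge integral, for which the fundamental theorem of calculus evaluates
  the exponentials.\<close>

lemma integral_unit_interval_measure:
  fixes f :: "real \<Rightarrow> complex"
  assumes "continuous_on UNIV f"
  shows "(\<integral>x. f x \<partial>unit_interval_measure) = integral {0..1} f"
proof -
  have [measurable]: "f \<in> borel_measurable borel"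
    using assms by (rule borel_measurable_continuous_onI)
  have "(\<integral>x. f x \<partial>unit_interval_measure) = (\<integral>x. indicator {0<..<1} x *\<^sub>R f x \<partial>lborel)"
  proof -
    have eq: "unit_interval_measure = density lborel (\<lambda>x. ennreal (indicator {0<..<1} x))"
      by (simp add: unit_interval_measure_def ennreal_indicator)
    show ?thesis unfolding eq by (subst integral_density) auto
  qed
  also have "\<dots> = (\<integral>x. indicator {0..1} x *\<^sub>R f x \<partial>lborel)"
  proof (rule integral_cong_AE)
    show "AE x in lborel. indicator {0<..<1} x *\<^sub>R f x = indicator {0..1} x *\<^sub>R f x"
      using AE_lborel_singleton[of 0] AE_lborel_singleton[of 1]
      by eventually_elim (auto simp: indicator_def)
  qed auto
  also have "\<dots> = integral {0..1} f"
    using borel_integrable_atLeastAtMost'[OF continuous_on_subset[OF assms], of 0 1]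
    by (simp add: set_borel_integral_eq_integral flip: set_lebesgue_integral_def)
  finally show ?thesis .
qed

lemma integral_exponential_unit_interval:
  "(\<integral>x. exponential (real_of_int n) x \<partial>unit_interval_measure) = (if n = 0 then 1 else 0)"
proof (cases "n = 0")
  case True
  interpret prob_space unit_interval_measure by (rule prob_space_unit_interval_measure)
  show ?thesis using True prob_space by (simp add: exponential_def)
next
  case False
  define c where "c = - 2 * of_real pi * \<i> * of_int n"
  have c: "c \<noteq> 0" using False by (simp add: c_def)
  have eq: "exponential (real_of_int n) = (\<lambda>x. exp (c * of_real x))"
    by (simp add: fun_eq_iff exponential_def c_def mult.assoc)
  have "((\<lambda>x. exp (c * of_real x)) has_integral exp (c * of_real 1) / c - exp (c * of_real 0) / c) {0..1}"
  proof (rule fundamental_theorem_of_calculus)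
    fix x :: real
    have "((\<lambda>z. exp (c * z) / c) has_field_derivative exp (c * of_real x)) (at (of_real x))"
      using c by (auto intro!: derivative_eq_intros)
    then show "((\<lambda>x. exp (c * of_real x) / c) has_vector_derivative exp (c * of_real x)) (at x within {0..1})"
      using has_vector_derivative_real_field has_vector_derivative_at_within by blast
  qed simp
  moreover have "exp c = 1"
    using exp_2pi_1_int[of "-n"] by (simp add: c_def mult_ac)
  ultimately have "integral {0..1} (\<lambda>x. exp (c * of_real x)) = 0"
    by (simp add: integral_unique)
  then show ?thesis
    using False
    by (subst integral_unit_interval_measure) (auto intro!: continuous_intros simp: eq)
qed

lemma is_spectrum_graph:
  fixes g :: "int \<Rightarrow> real"
  shows "is_spectrum segment_measure (range (\<lambda>n. vector [of_int n, g n] :: real^2))"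
proof -
  define \<gamma> where "\<gamma> n = (vector [of_int n, g n] :: real^2)" for n
  \<comment> \<open>The first coordinates separate the points whatever \<open>g\<close> is, so
    distinct points of the graph carry distinct integer frequencies.\<close>
  have inj: "inj \<gamma>" by (auto simp: inj_def \<gamma>_def vec_eq_iff forall_2)
  have expo: "exponential (\<gamma> n) (x *\<^sub>R axis 1 1) = exponential (of_int n :: real) x" for n x
    by (simp add: exponential_def \<gamma>_def inner_axis mult.commute)
  interpret prob_space segment_measure by (rule prob_space_segment_measure)
  have "uniform_discrete (range \<gamma>)"
    unfolding uniform_discrete_def
  proof (intro exI[of _ 1] conjI ballI impI)
    fix x y assume "x \<in> range \<gamma>" "y \<in> range \<gamma>" "dist x y < 1"
    then obtain m n where mn: "x = \<gamma> m" "y = \<gamma> n" by blast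
    have "\<bar>real_of_int m - real_of_int n\<bar> \<le> dist x y"
      using component_le_norm_cart[of "x - y" 1] by (simp add: mn \<gamma>_def dist_norm)
    then have "m = n" using \<open>dist x y < 1\<close> by linarith
    then show "x = y" by (simp add: mn)
  qed simp
  then have disc: "discrete (range \<gamma>)" using uniform_discrete_imp_discrete by blast
  have ortho: "orthonormal_family segment_measure exponential (range \<gamma>)"
    unfolding orthonormal_family_def
  proof (intro conjI ballI)
    show "exponential i \<in> L2_space segment_measure" for i :: "real^2"
      by (simp add: L2_space_def)
    fix i j assume "i \<in> range \<gamma>" "j \<in> range \<gamma>"
    then obtain m n where mn: "i = \<gamma> m" "j = \<gamma> n" by blast
    have "L2_inner segment_measure (exponential i) (exponential j) =
        (\<integral>x. exponential i (x *\<^sub>R axis 1 1) * cnj (exponential j (x *\<^sub>R axis 1 1)) \<partial>unit_interval_measure)"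
      unfolding L2_inner_def segment_measure_def by (rule integral_distr) (auto simp: exponential_mult_cnj)
    also have "\<dots> = (\<integral>x. exponential (real_of_int (m - n)) x \<partial>unit_interval_measure)"
      by (simp add: mn expo exponential_mult_cnj)
    finally show "L2_inner segment_measure (exponential i) (exponential j) = (if i = j then 1 else 0)"
      unfolding integral_exponential_unit_interval using inj by (simp add: mn inj_eq)
  qed
  have complete: "\<exists>J c. finite J \<and> J \<subseteq> range \<gamma> \<and>
      L2_norm segment_measure (\<lambda>x. f x - (\<Sum>j\<in>J. c j * exponential j x)) < \<epsilon>"
    if f: "f \<in> L2_space segment_measure" and "\<epsilon> > 0" for f \<epsilon>
  proof -
    have [measurable]: "f \<in> borel_measurable borel"
      using f measurable_cong_sets[OF sets_segment_measure refl] by (auto simp: L2_space_def)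
    define F where "F x = f (x *\<^sub>R axis 1 1)" for x
    have [measurable]: "F \<in> borel_measurable borel" unfolding F_def by measurable
    have "(\<integral>\<^sup>+x. ennreal ((cmod (F x))\<^sup>2) \<partial>unit_interval_measure) =
        (\<integral>\<^sup>+x. ennreal ((cmod (f x))\<^sup>2) \<partial>segment_measure)"
      unfolding segment_measure_def F_def by (subst nn_integral_distr) auto
    also have "\<dots> < \<infinity>"
      using f unfolding L2_space_def by (auto simp: integrable_iff_bounded)
    finally have "trig_approximable F" by (intro trig_approximable_L2) auto
    then obtain T where T: "trig_poly T"
      "(\<integral>\<^sup>+x. ennreal ((cmod (F x - T x))\<^sup>2) \<partial>unit_interval_measure) < ennreal (\<epsilon>\<^sup>2)"
      \<comment> \<open>The square of \<epsilon>, since \<open>L2_norm\<close> takes a root.\<close>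
      unfolding trig_approximable_def using \<open>\<epsilon> > 0\<close> zero_less_power by blast
    obtain J c where J: "finite J" "T = (\<lambda>x. \<Sum>n\<in>J. c n * exponential (of_int n) x)"
      using trig_poly_eq_sum[OF T(1)] by blast
    \<comment> \<open>Completeness indexes coefficients by points of the spectrum, so they are
      carried from the integers to the graph.\<close>
    define c' where "c' = c \<circ> the_inv \<gamma>"
    define h where "h x = f x - (\<Sum>j\<in>\<gamma> ` J. c' j * exponential j x)" for x
    have [measurable]: "h \<in> borel_measurable borel"
      unfolding h_def by measurable
    have h: "h (x *\<^sub>R axis 1 1) = F x - T x" for x
      unfolding h_def J(2) F_def
      by (subst sum.reindex[OF inj_on_subset[OF inj]]) (auto simp: c'_def expo the_inv_f_f[OF inj])
    have "(\<integral>x. (cmod (h x))\<^sup>2 \<partial>segment_measure) = enn2real (\<integral>\<^sup>+x. ennreal ((cmod (h x))\<^sup>2) \<partial>segment_measure)"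
      by (rule integral_eq_nn_integral) auto
    also have "(\<integral>\<^sup>+x. ennreal ((cmod (h x))\<^sup>2) \<partial>segment_measure) =
        (\<integral>\<^sup>+x. ennreal ((cmod (F x - T x))\<^sup>2) \<partial>unit_interval_measure)"
      unfolding segment_measure_def by (subst nn_integral_distr) (auto simp: h)
    also have "enn2real \<dots> < \<epsilon>\<^sup>2"
      using T(2) by (cases "\<integral>\<^sup>+x. ennreal ((cmod (F x - T x))\<^sup>2) \<partial>unit_interval_measure")
        (auto simp: ennreal_less_iff)
    finally have "L2_norm segment_measure h < \<epsilon>"
      unfolding L2_norm_def using \<open>\<epsilon> > 0\<close> by (simp add: real_sqrt_less_iff real_less_lsqrt)
    then show ?thesis
      using J(1) unfolding h_def by (intro exI[of _ "\<gamma> ` J"] exI[of _ c']) auto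
  qed
  show ?thesis
    unfolding is_spectrum_def orthonormal_basis_def
    using disc ortho complete by (simp add: \<gamma>_def[abs_def])
qed

section \<open>Beurling dimension of graphs\<close>

lemma upper_beurling_density_eq_0I:
  assumes bound: "eventually (\<lambda>h. \<forall>x. emeasure (count_space UNIV) (\<Lambda> \<inter> ball x h) \<le> ennreal (D h)) at_top"
    and lim: "((\<lambda>h. D h / h powr r) \<longlongrightarrow> 0) at_top"
  shows "upper_beurling_density r \<Lambda> = 0"
proof -
  have "eventually (\<lambda>h. (SUP x. emeasure (count_space UNIV) (\<Lambda> \<inter> ball x h)) / ennreal (h powr r)
      \<le> ennreal (D h / h powr r)) at_top"
    using bound eventually_gt_at_top[of 0]
  proof eventually_elim
    case (elim h)
    have "(SUP x. emeasure (count_space UNIV) (\<Lambda> \<inter> ball x h)) / ennreal (h powr r) \<le>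
        ennreal (D h) / ennreal (h powr r)"
      using elim by (intro divide_right_mono_ennreal SUP_least) auto
    also have "\<dots> \<le> ennreal (D h / h powr r)"
      using elim by (cases "D h \<ge> 0") (auto simp: divide_ennreal ennreal_neg)
    finally show ?case .
  qed
  then have "upper_beurling_density r \<Lambda> \<le> Limsup at_top (\<lambda>h. ennreal (D h / h powr r))"
    unfolding upper_beurling_density_def by (rule Limsup_mono)
  also have "\<dots> = 0"
    using tendsto_ennrealI[OF lim] by (simp add: lim_imp_Limsup)
  finally show ?thesis by simp
qed

text \<open>One fixed centre suffices, as the supremum over centres can only raise the
  quotient.\<close>

lemma upper_beurling_density_neq_0I:
  assumes bound: "eventually (\<lambda>h. ennreal (c * h powr r) \<le> emeasure (count_space UNIV) (\<Lambda> \<inter> ball x h)) at_top"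
    and c: "c > 0"
  shows "upper_beurling_density r \<Lambda> \<noteq> 0"
proof -
  have "eventually (\<lambda>h. ennreal c \<le>
      (SUP x. emeasure (count_space UNIV) (\<Lambda> \<inter> ball x h)) / ennreal (h powr r)) at_top"
    using bound eventually_gt_at_top[of 0]
  proof eventually_elim
    case (elim h)
    have "ennreal c = ennreal (c * h powr r) / ennreal (h powr r)"
      using elim c by (simp add: divide_ennreal)
    also have "\<dots> \<le> (SUP x. emeasure (count_space UNIV) (\<Lambda> \<inter> ball x h)) / ennreal (h powr r)"
      using elim by (intro divide_right_mono_ennreal SUP_upper2[of x]) auto
    finally show ?case .
  qed
  from Limsup_mono[OF this] have "ennreal c \<le> upper_beurling_density r \<Lambda>"
    unfolding upper_beurling_density_def by (simp add: Limsup_const)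
  then show ?thesis using c by (auto simp: ennreal_eq_0_iff)
qed

text \<open>At the critical exponent a nonzero density is enough: if the density vanished at some r
  < t, it would vanish at t as well. For t = 0 the lower bound is trivial.\<close>

lemma beurling_dim_eqI:
  assumes zero: "\<And>r. r > t \<Longrightarrow> upper_beurling_density r \<Lambda> = 0"
    and nonzero: "t > 0 \<Longrightarrow> upper_beurling_density t \<Lambda> \<noteq> 0" and "t \<ge> 0"
  shows "beurling_dim \<Lambda> = ennreal t"
proof (rule antisym)
  show "beurling_dim \<Lambda> \<le> ennreal t"
  proof (rule ennreal_le_epsilon)
    fix e :: real assume "e > 0"
    then have "beurling_dim \<Lambda> \<le> ennreal (t + e)"
      unfolding beurling_dim_def using zero[of "t + e"] \<open>t \<ge> 0\<close>
      by (intro Inf_lower CollectI exI[of _ "t + e"]) simp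
    then show "beurling_dim \<Lambda> \<le> ennreal t + ennreal e"
      using \<open>e > 0\<close> \<open>t \<ge> 0\<close> by simp
  qed
  show "ennreal t \<le> beurling_dim \<Lambda>"
    unfolding beurling_dim_def
  proof (rule Inf_greatest, clarify)
    fix r :: real assume r: "r > 0" "upper_beurling_density r \<Lambda> = 0"
    have "\<not> r < t"
      using upper_beurling_density_eq_0[of r \<Lambda> t] nonzero r by auto
    then show "ennreal t \<le> ennreal r" by (intro ennreal_leI) simp
  qed
qed

section \<open>Counting the points of a graph in a ball\<close>

lemma count_le_of_diff_le:
  fixes S :: "nat set"
  assumes diff: "\<And>m n. m \<in> S \<Longrightarrow> n \<in> S \<Longrightarrow> m \<le> n \<Longrightarrow> real n - real m \<le> D" and "D \<ge> 0"
  shows "finite S \<and> real (card S) \<le> D + 1"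
proof (cases "S = {}")
  case False
  define m where "m = (LEAST n. n \<in> S)"
  have m: "m \<in> S" "\<And>n. n \<in> S \<Longrightarrow> m \<le> n"
    using False by (auto simp: m_def intro: LeastI Least_le)
  \<comment> \<open>Both ends belong to the interval; this is the 1 in the bound D + 1.\<close>
  have sub: "S \<subseteq> {m..m + nat \<lfloor>D\<rfloor>}"
  proof
    fix n assume n: "n \<in> S"
    have "int n - int m \<le> \<lfloor>D\<rfloor>"
      using diff[OF m(1) n m(2)[OF n]] by (simp add: le_floor_iff)
    then show "n \<in> {m..m + nat \<lfloor>D\<rfloor>}" using m(2)[OF n] by auto
  qed
  have "card S \<le> nat \<lfloor>D\<rfloor> + 1" using card_mono[OF _ sub] by simp
  then have "real (card S) \<le> real (nat \<lfloor>D\<rfloor>) + 1" by linarith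
  also have "\<dots> \<le> D + 1" using \<open>D \<ge> 0\<close> by simp
  finally show ?thesis using finite_subset[OF sub] by simp
qed (use assms in simp)

text \<open>Spectra need every integer frequency, while growth is easier to handle on the naturals;
  using the absolute value costs a factor 2 in the counts.\<close>

definition even_graph :: "(nat \<Rightarrow> real) \<Rightarrow> real \<Rightarrow> (real^2) set" where
  "even_graph k a = range (\<lambda>n::int. vector [of_int n, k (nat \<bar>n\<bar>) + a])"

text \<open>Points of the graph in a ball of radius \<open>h\<close> have heights differing by less than \<open>2 h\<close>, so the
  growth of \<open>k\<close> confines \<open>|n|\<close> to an interval of length \<open>D\<close>.\<close>

lemma count_even_graph_le:
  assumes growth: "\<And>m n. m \<le> n \<Longrightarrow> k n - k m < 2 * h \<Longrightarrow> real n - real m \<le> D"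
    and "D \<ge> 0"
  shows "emeasure (count_space UNIV) (even_graph k a \<inter> ball x h) \<le> ennreal (2 * (D + 1))"
proof -
  define \<gamma> where "\<gamma> n = (vector [of_int n, k (nat \<bar>n\<bar>) + a] :: real^2)" for n
  define S where "S = {n. \<gamma> (int n) \<in> ball x h \<or> \<gamma> (- int n) \<in> ball x h}"
  \<comment> \<open>The unknown \<open>x $ 2\<close> and the shift \<open>a\<close> cancel in
    differences of heights, which makes the bound uniform in the centre.\<close>
  have height: "\<bar>k n + a - x $ 2\<bar> < h" if "n \<in> S" for n
  proof -
    have "\<exists>i. nat \<bar>i\<bar> = n \<and> \<gamma> i \<in> ball x h"
      using that unfolding S_def by (auto intro: exI[of _ "int n"] exI[of _ "- int n"])
    then obtain i where i: "nat \<bar>i\<bar> = n" "\<gamma> i \<in> ball x h" by blast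
    show ?thesis
      using component_le_norm_cart[of "\<gamma> i - x" 2] i by (auto simp: \<gamma>_def dist_norm norm_minus_commute)
  qed
  have S: "finite S" "real (card S) \<le> D + 1"
    using count_le_of_diff_le[of S D] growth height \<open>D \<ge> 0\<close> by (smt (verit))+
  have sub: "even_graph k a \<inter> ball x h \<subseteq> \<gamma> ` (int ` S \<union> (\<lambda>n. - int n) ` S)"
  proof
    fix y assume "y \<in> even_graph k a \<inter> ball x h"
    then obtain i where i: "y = \<gamma> i" "\<gamma> i \<in> ball x h"
      by (auto simp: even_graph_def \<gamma>_def)
    have "i \<in> int ` S \<union> (\<lambda>n. - int n) ` S"
    proof (cases "i \<ge> 0")
      case True
      then have "nat i \<in> S" "i = int (nat i)" using i by (auto simp: S_def)
      then show ?thesis by blast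
    next
      case False
      then have "nat (- i) \<in> S" "i = - int (nat (- i))" using i by (auto simp: S_def)
      then show ?thesis by blast
    qed
    then show "y \<in> \<gamma> ` (int ` S \<union> (\<lambda>n. - int n) ` S)" using i by blast
  qed
  have fin: "finite (even_graph k a \<inter> ball x h)"
    using finite_subset[OF sub] S by simp
  have "card (even_graph k a \<inter> ball x h) \<le> card (int ` S \<union> (\<lambda>n. - int n) ` S)"
    using S by (intro order_trans[OF card_mono[OF _ sub] card_image_le]) auto
  also have "\<dots> \<le> card (int ` S) + card ((\<lambda>n. - int n) ` S)" by (rule card_Un_le)
  also have "\<dots> \<le> card S + card S" by (intro add_mono card_image_le S)
  finally have "real (card (even_graph k a \<inter> ball x h)) \<le> real (card S + card S)"
    by (rule of_nat_mono)
  then have "real (card (even_graph k a \<inter> ball x h)) \<le> 2 * (D + 1)" using S(2) by simp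
  then show ?thesis
    using fin by (simp add: emeasure_count_space_finite ennreal_of_nat_eq_real_of_nat ennreal_leI)
qed

text \<open>Write c^s as c * c^(s - 1); the second factor is monotone in c because s \<ge>
  1.\<close>

lemma powr_add_ge:
  fixes a b s :: real
  assumes "a \<ge> 0" "b \<ge> 0" "s \<ge> 1"
  shows "a powr s + b powr s \<le> (a + b) powr s"
proof -
  have split: "c powr s = c * c powr (s - 1)" if "c \<ge> 0" for c
    using that by (cases "c = 0") (auto simp: powr_mult_base)
  have "a powr s + b powr s \<le> a * (a + b) powr (s - 1) + b * (a + b) powr (s - 1)"
    unfolding split[OF assms(1)] split[OF assms(2)]
    using assms by (intro add_mono mult_left_mono powr_mono2) auto
  also have "\<dots> = (a + b) powr s"
    using split[of "a + b"] assms by (simp add: distrib_right)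
  finally show ?thesis .
qed

lemma beurling_dim_power_graph:
  assumes t: "0 < t" "t \<le> 1"
  shows "beurling_dim (even_graph (\<lambda>n. real n powr (1 / t)) a) = ennreal t"
proof (rule beurling_dim_eqI)
  let ?k = "\<lambda>n. real n powr (1 / t)"
  have s: "1 / t \<ge> 1" using t by simp
  fix r assume "r > t"
  show "upper_beurling_density r (even_graph ?k a) = 0"
  proof (rule upper_beurling_density_eq_0I)
    show "eventually (\<lambda>h. \<forall>x. emeasure (count_space UNIV) (even_graph ?k a \<inter> ball x h) \<le>
        ennreal (2 * ((2 * h) powr t + 1))) at_top"
      using eventually_gt_at_top[of 0]
    proof eventually_elim
      case (elim h)
      have "real n - real m \<le> (2 * h) powr t" if mn: "m \<le> n" "?k n - ?k m < 2 * h" for m n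
      proof -
        \<comment> \<open>Superadditivity for m and n - m: the power of the gap is at most the gap
          of the powers.\<close>
        have "(real n - real m) powr (1 / t) \<le> 2 * h"
          using powr_add_ge[of "real m" "real n - real m" "1 / t"] s mn by simp
        then have "((real n - real m) powr (1 / t)) powr t \<le> (2 * h) powr t"
          using t by (intro powr_mono2) auto
        then show ?thesis using t mn by (simp add: powr_powr)
      qed
      then show ?case by (intro allI count_even_graph_le) auto
    qed
    have "((\<lambda>h. 2 * (2 powr t * h powr (t - r)) + 2 * h powr (- r)) \<longlongrightarrow> 2 * (2 powr t * 0) + 2 * 0) at_top"
      using \<open>r > t\<close> t by (intro tendsto_intros tendsto_neg_powr filterlim_ident) auto
    then have "((\<lambda>h. 2 * (2 powr t * h powr (t - r)) + 2 * h powr (- r)) \<longlongrightarrow> 0) at_top" by simp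
    then show "((\<lambda>h. 2 * ((2 * h) powr t + 1) / h powr r) \<longlongrightarrow> 0) at_top"
    proof (rule Lim_transform_eventually)
      show "eventually (\<lambda>h. 2 * (2 powr t * h powr (t - r)) + 2 * h powr (- r) =
          2 * ((2 * h) powr t + 1) / h powr r) at_top"
        using eventually_gt_at_top[of 0]
        by eventually_elim (simp add: powr_diff powr_minus powr_mult field_simps)
    qed
  qed
next
  let ?k = "\<lambda>n. real n powr (1 / t)"
  define \<gamma> where "\<gamma> n = (vector [of_int n, ?k (nat \<bar>n\<bar>) + a] :: real^2)" for n
  \<comment> \<open>Each coordinate offset gets half of the radius, so the indices below (h / 2)^t
    are counted.\<close>
  define c where "c = (1 / 2) powr t"
  show "upper_beurling_density t (even_graph ?k a) \<noteq> 0"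
  proof (rule upper_beurling_density_neq_0I[where c = c and x = "vector [0, a]"])
    show "c > 0" by (simp add: c_def)
    show "eventually (\<lambda>h. ennreal (c * h powr t) \<le>
        emeasure (count_space UNIV) (even_graph ?k a \<inter> ball (vector [0, a]) h)) at_top"
      using eventually_gt_at_top[of 0]
    proof eventually_elim
      case (elim h)
      define X where "X = (h / 2) powr t"
      have X: "c * h powr t = X" "X \<ge> 0"
        using elim by (simp_all add: c_def X_def powr_divide)
      \<comment> \<open>With the ceiling, n < N still means n < X, while N is at least X.\<close>
      define N where "N = nat \<lceil>X\<rceil>"
      have sub: "(\<lambda>n. \<gamma> (int n)) ` {..<N} \<subseteq> even_graph ?k a \<inter> ball (vector [0, a]) h"
      proof clarify
        fix n assume "n < N"
        then have nX: "real n < X" unfolding N_def by linarith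
        have "real n powr (1 / t) < X powr (1 / t)"
          using nX t by (intro powr_less_mono2) auto
        also have "\<dots> = h / 2" using t elim by (simp add: X_def powr_powr)
        finally have k: "?k n < h / 2" .
        \<comment> \<open>The horizontal offset is at most the vertical one, hence also below h /
          2.\<close>
        have "real n \<le> ?k n"
        proof (cases "n = 0")
          case False
          then show ?thesis using powr_mono[of 1 "1 / t" "real n"] t by simp
        qed simp
        with k have n: "real n < h / 2" by simp
        have "norm (\<gamma> (int n) - vector [0, a]) \<le> \<bar>real n\<bar> + \<bar>?k n\<bar>"
          using norm_le_l1_cart[of "\<gamma> (int n) - vector [0, a]"] by (simp add: sum_2 \<gamma>_def)
        also have "\<dots> < h" using n k by simp
        finally show "\<gamma> (int n) \<in> even_graph ?k a \<inter> ball (vector [0, a]) h"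
          unfolding even_graph_def \<gamma>_def[symmetric] by (simp add: dist_norm norm_minus_commute)
      qed
      have inj: "inj_on (\<lambda>n. \<gamma> (int n)) {..<N}"
        by (auto simp: inj_on_def \<gamma>_def vec_eq_iff forall_2)
      have "ennreal X \<le> ennreal (real N)"
        unfolding N_def by (intro ennreal_leI) (simp add: of_nat_ceiling)
      also have "\<dots> = emeasure (count_space UNIV) ((\<lambda>n. \<gamma> (int n)) ` {..<N})"
        by (subst emeasure_count_space_finite) (auto simp: card_image[OF inj] ennreal_of_nat_eq_real_of_nat)
      also have "\<dots> \<le> emeasure (count_space UNIV) (even_graph ?k a \<inter> ball (vector [0, a]) h)"
        using sub by (intro emeasure_mono) auto
      finally show ?case unfolding X .
    qed
  qed
qed (use t in simp)

text \<open>A ball of radius h holds at most a multiple of log h points for large h, which is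
  negligible against every positive power of h.\<close>

lemma beurling_dim_exponential_graph: "beurling_dim (even_graph (\<lambda>n. 2 ^ n) a) = 0"
proof -
  let ?k = "\<lambda>n::nat. 2 ^ n :: real"
  have "upper_beurling_density r (even_graph ?k a) = 0" if "r > 0" for r
  proof (rule upper_beurling_density_eq_0I)
    show "eventually (\<lambda>h. \<forall>x. emeasure (count_space UNIV) (even_graph ?k a \<inter> ball x h) \<le>
        ennreal (2 * (log 2 (4 * h) + 1))) at_top"
      using eventually_gt_at_top[of 1]
    proof eventually_elim
      case (elim h)
      have "real n - real m \<le> log 2 (4 * h)" if mn: "m \<le> n" "?k n - ?k m < 2 * h" for m n
      proof (cases "m = n")
        case True
        then show ?thesis using elim by simp
      next
        case False
        \<comment> \<open>With n = m + d + 1, the gap 2^n - 2^m is at least 2^(m + d), hence at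
          least 2^d. Doubling gives 2^(d + 1) < 4 h, which bounds n - m itself.\<close>
        then obtain d where d: "n = Suc (m + d)" using mn less_imp_Suc_add by (metis le_neq_implies_less)
        have "(2::real) ^ d \<le> 2 ^ (m + d)" by (intro power_increasing) auto
        also have "\<dots> \<le> ?k n - ?k m"
        proof -
          have "(2::real) ^ m \<le> 2 ^ (m + d)" by (intro power_increasing) auto
          then show ?thesis by (simp add: d)
        qed
        finally have "2 ^ Suc d < 4 * h" using mn by simp
        then have "2 powr real (Suc d) < 4 * h" by (simp only: powr_realpow[OF zero_less_numeral])
        then have "real (Suc d) < log 2 (4 * h)" using elim by (subst less_log_iff) auto
        then show ?thesis by (simp add: d)
      qed
      then show ?case using elim by (intro allI count_even_graph_le) auto
    qed
    have ln: "((\<lambda>h. ln h / h powr r) \<longlongrightarrow> 0) at_top"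
    proof (rule Lim_null_comparison)
      \<comment> \<open>The logarithm is bounded by a multiple of h^(r / 2), leaving half of the
        exponent for decay.\<close>
      show "eventually (\<lambda>h. norm (ln h / h powr r) \<le> h powr (- (r / 2)) / (r / 2)) at_top"
        using eventually_gt_at_top[of 1]
      proof eventually_elim
        case (elim h)
        have "ln h / h powr r \<le> h powr (r / 2) / (r / 2) / h powr r"
          using elim \<open>r > 0\<close> by (intro divide_right_mono ln_powr_bound) auto
        also have "\<dots> = h powr (- (r / 2)) / (r / 2)"
        proof -
          have "h powr r = h powr (r / 2) * h powr (r / 2)"
            by (simp flip: powr_add)
          then show ?thesis
            using elim by (simp add: powr_minus divide_simps)
        qed
        finally show ?case using elim by simp
      qed
      show "((\<lambda>h. h powr (- (r / 2)) / (r / 2)) \<longlongrightarrow> 0) at_top"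
        using \<open>r > 0\<close> by (intro tendsto_divide_zero tendsto_neg_powr filterlim_ident) auto
    qed
    have "((\<lambda>h. 2 / ln 2 * (ln h / h powr r) + (2 * log 2 4 + 2) * h powr (- r)) \<longlongrightarrow>
        2 / ln 2 * 0 + (2 * log 2 4 + 2) * 0) at_top"
      using \<open>r > 0\<close>
      by (intro tendsto_add tendsto_mult tendsto_const ln tendsto_neg_powr filterlim_ident) auto
    then have "((\<lambda>h. 2 / ln 2 * (ln h / h powr r) + (2 * log 2 4 + 2) * h powr (- r)) \<longlongrightarrow> 0) at_top"
      by simp
    then show "((\<lambda>h. 2 * (log 2 (4 * h) + 1) / h powr r) \<longlongrightarrow> 0) at_top"
    proof (rule Lim_transform_eventually)
      show "eventually (\<lambda>h. 2 / ln 2 * (ln h / h powr r) + (2 * log 2 4 + 2) * h powr (- r) =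
          2 * (log 2 (4 * h) + 1) / h powr r) at_top"
        using eventually_gt_at_top[of 0]
      proof eventually_elim
        case (elim h)
        then have log: "log 2 (4 * h) = log 2 4 + ln h / ln 2"
          by (simp add: log_mult log_def[of 2 h])
        show ?case unfolding log using elim by (simp add: powr_minus field_simps)
      qed
    qed
  qed
  then show ?thesis using beurling_dim_eqI[of 0 "even_graph ?k a"] by simp
qed

section \<open>The cardinality of the level sets\<close>

text \<open>A discrete set is determined by which basic open sets \<open>U\<close> meet it in a single point, together with
  the basic open sets \<open>V\<close> containing that point.\<close>

lemma discrete_sets_lepoll_real:
  "{\<Lambda> :: 'a::{second_countable_topology, t1_space} set. discrete \<Lambda>} \<lesssim> (UNIV :: real set)"
proof -
  obtain \<B> :: "'a set set" where \<B>: "countable \<B>" "topological_basis \<B>"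
    using ex_countable_basis by blast
  define P where "P \<Lambda> = {(U, V) \<in> \<B> \<times> \<B>. \<exists>y\<in>V. \<Lambda> \<inter> U = {y}}" for \<Lambda> :: "'a set"
  have recover: "x \<in> \<Lambda> \<longleftrightarrow> (\<exists>U\<in>\<B>. x \<in> U \<and> (\<forall>V\<in>\<B>. x \<in> V \<longrightarrow> (U, V) \<in> P \<Lambda>))"
    if "discrete \<Lambda>" for x \<Lambda>
  proof
    assume "x \<in> \<Lambda>"
    with that obtain T where T: "open T" "T \<inter> \<Lambda> = {x}"
      by (auto simp: discrete_def isolated_in_def)
    then obtain U where "U \<in> \<B>" "x \<in> U" "U \<subseteq> T"
      using topological_basisE[OF \<B>(2), of T x] by blast
    moreover have "\<Lambda> \<inter> U = {x}" using T \<open>x \<in> U\<close> \<open>U \<subseteq> T\<close> by blast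
    ultimately show "\<exists>U\<in>\<B>. x \<in> U \<and> (\<forall>V\<in>\<B>. x \<in> V \<longrightarrow> (U, V) \<in> P \<Lambda>)"
      by (auto simp: P_def)
  next
    assume "\<exists>U\<in>\<B>. x \<in> U \<and> (\<forall>V\<in>\<B>. x \<in> V \<longrightarrow> (U, V) \<in> P \<Lambda>)"
    then obtain U where U: "U \<in> \<B>" "x \<in> U" "\<And>V. V \<in> \<B> \<Longrightarrow> x \<in> V \<Longrightarrow> \<exists>y\<in>V. \<Lambda> \<inter> U = {y}"
      by (auto simp: P_def)
    obtain y where y: "\<Lambda> \<inter> U = {y}" using U(3)[OF U(1,2)] by blast
    \<comment> \<open>The point y lies in every basic neighbourhood of x, so T1 separation forces
      equality.\<close>
    have "x = y"
    proof (rule ccontr)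
      assume "x \<noteq> y"
      then obtain W where "open W" "x \<in> W" "y \<notin> W" using t1_space by blast
      then obtain V where "V \<in> \<B>" "x \<in> V" "V \<subseteq> W"
        using topological_basisE[OF \<B>(2), of W x] by blast
      with U(3)[of V] y \<open>y \<notin> W\<close> show False by auto
    qed
    then show "x \<in> \<Lambda>" using y by blast
  qed
  have "inj_on P {\<Lambda>. discrete \<Lambda>}"
    by (intro inj_onI set_eqI) (simp add: recover)
  \<comment> \<open>Pairs of basic sets are countably many, so a set of pairs can be coded as a set
    of naturals.\<close>
  moreover have "inj_on (image (to_nat_on (\<B> \<times> \<B>))) (Pow (\<B> \<times> \<B>))"
    using \<B>(1) by (intro inj_on_image_Pow inj_on_to_nat_on countable_SIGMA)
  moreover have "P ` {\<Lambda>. discrete \<Lambda>} \<subseteq> Pow (\<B> \<times> \<B>)" by (auto simp: P_def)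
  ultimately have "inj_on (image (to_nat_on (\<B> \<times> \<B>)) \<circ> P) {\<Lambda>. discrete \<Lambda>}"
    by (intro comp_inj_on) (auto intro: inj_on_subset)
  then have "{\<Lambda> :: 'a set. discrete \<Lambda>} \<lesssim> (UNIV :: nat set set)"
    unfolding lepoll_def by blast
  then show ?thesis
    using nat_sets_eqpoll_reals lepoll_trans eqpoll_imp_lepoll by blast
qed

theorem theorem1p4:
  fixes R :: "real^2^2" and B :: "(real^2) set" and t :: real
  assumes "R = vector [vector [2, 1], vector [0, 2]]"
    and "B = {vector [0, 0], vector [1, 0]}"
    and "0 \<le> t" and "t \<le> 1"
  shows "{\<Lambda>. is_spectrum (self_affine_measure R B) \<Lambda> \<and> beurling_dim \<Lambda> = ennreal t}
           \<approx> (UNIV :: real set)"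
proof -
  note \<mu> = self_affine_measure_shear[OF assms(1,2)]
  obtain k :: "nat \<Rightarrow> real" where k: "\<And>a. beurling_dim (even_graph k a) = ennreal t"
  proof (cases "t = 0")
    case True
    then show ?thesis using that[of "\<lambda>n. 2 ^ n"] beurling_dim_exponential_graph by simp
  next
    case False
    then show ?thesis
      using that[of "\<lambda>n. real n powr (1 / t)"] beurling_dim_power_graph[of t] assms(3,4) by simp
  qed
  show ?thesis
  proof (rule lepoll_antisym)
    have "{\<Lambda>. is_spectrum (self_affine_measure R B) \<Lambda> \<and> beurling_dim \<Lambda> = ennreal t} \<subseteq>
        {\<Lambda>. discrete \<Lambda>}"
      by (auto simp: is_spectrum_def)
    then show "{\<Lambda>. is_spectrum (self_affine_measure R B) \<Lambda> \<and> beurling_dim \<Lambda> = ennreal t} \<lesssim> (UNIV :: real set)"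
      using discrete_sets_lepoll_real lepoll_trans subset_imp_lepoll by blast
    have "inj (even_graph k)"
    proof (rule injI)
      fix a b assume eq: "even_graph k a = even_graph k b"
      \<comment> \<open>The graph has exactly one point with first coordinate 0, and its height
        determines the shift.\<close>
      have "vector [of_int 0, k (nat \<bar>0\<bar>) + a] \<in> even_graph k a"
        unfolding even_graph_def by (rule rangeI)
      then show "a = b"
        unfolding eq by (auto simp: even_graph_def vec_eq_iff forall_2)
    qed
    moreover have "range (even_graph k) \<subseteq>
        {\<Lambda>. is_spectrum (self_affine_measure R B) \<Lambda> \<and> beurling_dim \<Lambda> = ennreal t}"
      unfolding \<mu> using k by (auto simp: even_graph_def intro: is_spectrum_graph)
    ultimately show "(UNIV :: real set) \<lesssim>
        {\<Lambda>. is_spectrum (self_affine_measure R B) \<Lambda> \<and> beurling_dim \<Lambda> = ennreal t}"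
      unfolding lepoll_def by blast
  qed
qed

end
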